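(* Fix $\alpha\in(1,\infty)$, $n>p$, $\beta_0\in\mathbb{R}^p$ and $\lambda>0$, and let $y=X\beta_0+\varepsilon$, where $\varepsilon\in\mathbb{R}^n$ is random with i.i.d. components of mean zero and variance $\sigma^2$, such that $U=n^{-1}X^{\mathsf T}\varepsilon$ has a density $g_{n,X}$ on $\mathbb{R}^p$. If $\mathrm{rank}(X)=p$, then the distribution of the augmented estimator $(\hat\gamma_{\mathcal A},S,\mathcal A)$ is given, for $(r_A,s,A)\in\Omega$, by the $p$-form $$d\mu_A=g_{n,X}\big(H_A(r_A,s;\beta_0,\lambda)\big)\,|\det M(r_A,s,A;\lambda)|\,d\theta,\qquad\theta=(r_A,s_F)\in\mathbb{R}^p .$$ Explicitly: for every $A\subset\{1,\dots,J\}$, every Borel $\Gamma\subset(0,\infty)^{|A|}$, every relatively open $\Phi_0\subset\mathcal M_A$ parameterized by $s_F$ with inverse parameterization $s(\cdot)$, and every Borel $\Delta\subset\{s_F:s\in\Phi_0\}$, with $\Phi=\{s(u):u\in\Delta\}$, $$\mathbb{P}(\hat\gamma_A\in\Gamma,S\in\Phi,\mathcal A=A)=\int_\Gamma\int_\Delta g_{n,X}\big(H_A(r_A,s(u);\beta_0,\lambda)\big)\,|\det M(r_A,s(u),A;\lambda)|\,du\,dr_A .$$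
   Context: Setup. $X\in\mathbb{R}^{n\times p}$; $\{1,\dots,p\}$ is partitioned into nonempty groups $\mathcal{G}_1,\dots,\mathcal{G}_J$, $p_j=|\mathcal{G}_j|$. For $v\in\mathbb{R}^p$, $v_{(j)}=(v_k)_{k\in\mathcal{G}_j}$; for a matrix $M$ with $p$ columns, $M_{(j)}$ is the submatrix of the columns in $\mathcal{G}_j$. Weights $w_j>0$; $W$ is the $p\times p$ diagonal matrix with entry $w_j$ at indices in $\mathcal{G}_j$. $\Psi=\frac1nX^{\mathsf T}X$. $1/\alpha+1/\alpha^*=1$, $\rho=\alpha^*/\alpha$, $\eta(x)=\mathrm{sgn}(x)|x|^\rho$ for $x\in[-1,1]$, $\eta'(x)=\rho|x|^{\rho-1}$ (with the convention $\eta'(0)=0$ if $\rho<1$); $\eta$ acts componentwise on vectors. Block Lasso: $\hat\beta\in\arg\min_{\beta\in\mathbb{R}^p}\{\frac1{2n}\|y-X\beta\|^2+\lambda\sum_jw_j\|\beta_{(j)}\|_\alpha\}$ (unique here). The subgradient vector $S$ is defined by $\frac1nX^{\mathsf T}X\hat\beta+\lambda WS=\frac1nX^{\mathsf T}y$ (so $S_{(j)}\in\partial\|\cdot\|_\alpha(\hat\beta_{(j)})$). $\hat\gamma_j=\|\hat\beta_{(j)}\|_\alpha$, $\mathcal A=\{j:\hat\beta_{(j)}\neq0\}$, $\hat\gamma_A=(\hat\gamma_j)_{j\in A}$; $(\hat\beta,S)$ is represented by $(\hat\gamma_{\mathcal A},S,\mathcal A)$, using $\hat\beta_{(j)}=\hat\gamma_j\eta(S_{(j)})$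 for $j\in\mathcal A$. Sample space (here the row space of $X$ is all of $\mathbb{R}^p$). For $A\subset\{1,\dots,J\}$: $\mathcal M_A=\{s\in\mathbb{R}^p:\|s_{(j)}\|_{\alpha^*}=1\ \forall j\in A,\ \|s_{(j)}\|_{\alpha^*}\le1\ \forall j\notin A\}$, $\Omega_A=(0,\infty)^{|A|}\times\mathcal M_A$, $\Omega=\bigcup_A\Omega_A\times\{A\}$; put $r_j=0$ for $j\notin A$. Parameterization. Let $F\subset\{1,\dots,p\}$, $|F|=p-|A|$. A relatively open $\Phi_0\subset\mathcal M_A$ is parameterized by $s_F=(s_k)_{k\in F}$ if $s\mapsto s_F$ is injective on $\Phi_0$ with open image in $\mathbb{R}^{p-|A|}$ and its inverse $u\mapsto s(u)$ is $C^1$; $T\in\mathbb{R}^{p\times(p-|A|)}$ is the derivative matrix of this inverse, so $ds=T\,ds_F$. (If $|A|=p$, $\Phi_0$ is a point, $T$ is empty and integration over $\Delta$ is evaluation.) $H_A(r_A,s;\beta_0,\lambda)=\sum_{j\in A}r_j\Psi_{(j)}\eta(s_{(j)})+\lambda Ws-\Psi\beta_0\in\mathbb{R}^p$. $r\circ\Psi=[r_1\Psi_{(1)}|\cdots|r_J\Psi_{(J)}]\in\mathbb{R}^{p\times p}$ (block $r_j\Psi_{(j)}$ occupying the columns in $\mathcal{G}_j$); $(\Psi\circ\eta)_A$ is the $p\times|A|$ matrix with columns $\Psi_{(j)}\eta(s_{(j)})$, $j\in A$; $D$ is the $p\times p$ diagonal matrix with $D_{kk}=\eta'(s_k)$ for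 $k\in\bigcup_{j\in A}\mathcal{G}_j$ and $0$ otherwise; $M(r_A,s,A;\lambda)=[(\Psi\circ\eta)_A\mid\{(r\circ\Psi)D+\lambda W\}T]\in\mathbb{R}^{p\times p}$. *)

theory Defs
  imports "HOL-Probability.Probability"
begin

text \<open>
  Dimensions that vary with \<open>A\<close> and \<open>F\<close> are handled by zero padding: for a subset \<open>K\<close> of the
  finite index type, \<open>\<real>\<^sup>K\<close> is the coordinate subspace of vectors vanishing outside \<open>K\<close>, and
  \<open>v\<^sub>K\<close> is the projection of \<open>v\<close> to it.
\<close>

definition coord_space :: "'i::finite set \<Rightarrow> (real^'i) set" where
  "coord_space K = {v. \<forall>k. k \<notin> K \<longrightarrow> v $ k = 0}"

definition coord_proj :: "'i::finite set \<Rightarrow> real^'i \<Rightarrow> real^'i" where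
  "coord_proj K v = (\<chi> k. if k \<in> K then v $ k else 0)"

text \<open>
  Lebesgue measure of dimension \<open>card K\<close> on \<open>coord_space K\<close>; for \<open>K = {}\<close> it is the unit point mass
  at \<open>0\<close>, so that integration is evaluation.
\<close>

definition coord_lborel :: "'i::finite set \<Rightarrow> (real^'i) measure" where
  "coord_lborel K =
     distr (Pi\<^sub>M K (\<lambda>_. lborel)) borel (\<lambda>x. \<chi> k. if k \<in> K then x k else 0)"

definition lp_norm :: "real \<Rightarrow> real^'i::finite \<Rightarrow> real" where
  "lp_norm a v = (\<Sum>k\<in>UNIV. \<bar>v $ k\<bar> powr a) powr (1 / a)"

text \<open>
  A partition of the coordinates into nonempty groups labelled by \<open>'j\<close> is given by a surjection
  \<open>grp\<close> sending each coordinate to the label of its group.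
\<close>

definition group_of :: "('p \<Rightarrow> 'j) \<Rightarrow> 'j \<Rightarrow> 'p set" where
  "group_of grp j = {k. grp k = j}"

definition block :: "('p::finite \<Rightarrow> 'j) \<Rightarrow> 'j \<Rightarrow> real^'p \<Rightarrow> real^'p" where
  "block grp j v = coord_proj (group_of grp j) v"

definition gram :: "real^'p^'n \<Rightarrow> real^'p^'p" where
  "gram X = (1 / real CARD('n)) *\<^sub>R (transpose X ** X)"

definition weight_mat :: "('p \<Rightarrow> 'j) \<Rightarrow> real^'j \<Rightarrow> real^'p^'p" where
  "weight_mat grp w = (\<chi> k l. if k = l then w $ grp k else 0)"

definition lasso_objective ::
  "('p \<Rightarrow> 'j) \<Rightarrow> real \<Rightarrow> real^'j \<Rightarrow> real \<Rightarrow> real^'p^'n \<Rightarrow> real^'n \<Rightarrow> real^'p \<Rightarrow> real"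
where
  "lasso_objective grp alpha w lam X y b =
     1 / (2 * real CARD('n)) * (norm (y - X *v b))\<^sup>2
     + lam * (\<Sum>j\<in>UNIV. w $ j * lp_norm alpha (block grp j b))"

definition block_lasso ::
  "('p \<Rightarrow> 'j) \<Rightarrow> real \<Rightarrow> real^'j \<Rightarrow> real \<Rightarrow> real^'p^'n \<Rightarrow> real^'n \<Rightarrow> real^'p \<Rightarrow> bool"
where
  "block_lasso grp alpha w lam X y b \<longleftrightarrow>
     is_arg_min (lasso_objective grp alpha w lam X y) (\<lambda>_. True) b"

definition lasso_subgradient ::
  "('p \<Rightarrow> 'j) \<Rightarrow> real^'j \<Rightarrow> real \<Rightarrow> real^'p^'n \<Rightarrow> real^'n \<Rightarrow> real^'p \<Rightarrow> real^'p \<Rightarrow> bool"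
where
  "lasso_subgradient grp w lam X y b S \<longleftrightarrow>
     gram X *v b + lam *\<^sub>R (weight_mat grp w *v S)
       = (1 / real CARD('n)) *\<^sub>R (transpose X *v y)"

definition block_norms :: "('p \<Rightarrow> 'j) \<Rightarrow> real \<Rightarrow> real^'p \<Rightarrow> real^'j" where
  "block_norms grp alpha b = (\<chi> j. lp_norm alpha (block grp j b))"

definition active_set :: "('p \<Rightarrow> 'j) \<Rightarrow> real^'p \<Rightarrow> 'j set" where
  "active_set grp b = {j. block grp j b \<noteq> 0}"

definition eta :: "real \<Rightarrow> real \<Rightarrow> real" where
  "eta rho x = sgn x * \<bar>x\<bar> powr rho"

text \<open>
  Since \<open>0 powr 0 = 0\<close>, the case \<open>\<rho> = 1\<close>, where \<open>\<eta>\<close> is the identity, is separate; for all other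
  \<open>\<rho>\<close> the value at \<open>0\<close> is \<open>0\<close>, as it should be (by convention if \<open>\<rho> < 1\<close>).
\<close>

definition eta' :: "real \<Rightarrow> real \<Rightarrow> real" where
  "eta' rho x = (if rho = 1 then 1 else rho * \<bar>x\<bar> powr (rho - 1))"

definition eta_vec :: "real \<Rightarrow> real^'p \<Rightarrow> real^'p" where
  "eta_vec rho v = (\<chi> k. eta rho (v $ k))"

definition subgrad_space :: "('p::finite \<Rightarrow> 'j) \<Rightarrow> real \<Rightarrow> 'j set \<Rightarrow> (real^'p) set" where
  "subgrad_space grp alphas A =
     {s. (\<forall>j\<in>A. lp_norm alphas (block grp j s) = 1) \<and>
         (\<forall>j. j \<notin> A \<longrightarrow> lp_norm alphas (block grp j s) \<le> 1)}"

text \<open>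
  \<open>\<Phi>\<^sub>0\<close> is parameterized by its coordinates in \<open>F\<close>, with inverse parameterization \<open>sp\<close> of class \<open>C\<^sup>1\<close>
  and derivative matrix \<open>T u\<close>. Only the columns of \<open>T u\<close> with index in \<open>F\<close> are meaningful; the others
  are unconstrained and never used.
\<close>

definition parameterized_by ::
  "'p::finite set \<Rightarrow> (real^'p) set \<Rightarrow> (real^'p \<Rightarrow> real^'p) \<Rightarrow> (real^'p \<Rightarrow> real^'p^'p) \<Rightarrow> bool"
where
  "parameterized_by F \<Phi>0 sp T \<longleftrightarrow>
     inj_on (coord_proj F) \<Phi>0 \<and>
     openin (top_of_set (coord_space F)) (coord_proj F ` \<Phi>0) \<and>
     (\<forall>s\<in>\<Phi>0. sp (coord_proj F s) = s) \<and>
     (\<forall>u \<in> coord_proj F ` \<Phi>0. (sp has_derivative (\<lambda>h. T u *v h)) (at u within coord_space F)) \<and>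
     (\<forall>k\<in>F. continuous_on (coord_proj F ` \<Phi>0) (\<lambda>u. column k (T u)))"

text \<open>\<open>gram X *v eta_vec rho (block grp j s)\<close> is \<open>\<Psi>\<^sub>(\<^sub>j\<^sub>) \<eta>(s\<^sub>(\<^sub>j\<^sub>))\<close>, because \<open>\<eta>(0) = 0\<close>.\<close>

definition H_map ::
  "('p \<Rightarrow> 'j::finite) \<Rightarrow> real \<Rightarrow> real^'j \<Rightarrow> real^'p^'n \<Rightarrow> 'j set
    \<Rightarrow> real^'j \<Rightarrow> real^'p \<Rightarrow> real^'p \<Rightarrow> real \<Rightarrow> real^'p"
where
  "H_map grp rho w X A r s \<beta>0 lam =
     (\<Sum>j\<in>A. r $ j *\<^sub>R (gram X *v eta_vec rho (block grp j s)))
     + lam *\<^sub>R (weight_mat grp w *v s) - gram X *v \<beta>0"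

definition r_circ_gram :: "('p \<Rightarrow> 'j) \<Rightarrow> real^'j \<Rightarrow> real^'p^'n \<Rightarrow> real^'p^'p" where
  "r_circ_gram grp r X = (\<chi> i k. r $ grp k * gram X $ i $ k)"

definition D_mat :: "('p \<Rightarrow> 'j) \<Rightarrow> real \<Rightarrow> 'j set \<Rightarrow> real^'p \<Rightarrow> real^'p^'p" where
  "D_mat grp rho A s =
     (\<chi> k l. if k = l \<and> grp k \<in> A then eta' rho (s $ k) else 0)"

text \<open>
  The columns of \<open>M\<close> are indexed by the disjoint sum of \<open>A\<close> and \<open>F\<close>, and \<open>c\<close> enumerates this sum by
  the row indices so that \<open>M\<close> becomes a square matrix. The absolute value of the determinant does
  not depend on the enumeration.
\<close>

definition M_mat ::
  "('p \<Rightarrow> 'j + 'p) \<Rightarrow> ('p \<Rightarrow> 'j) \<Rightarrow> real \<Rightarrow> real^'j \<Rightarrow> real^'p^'n \<Rightarrow> 'j set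
    \<Rightarrow> real^'j \<Rightarrow> real^'p \<Rightarrow> real^'p^'p \<Rightarrow> real \<Rightarrow> real^'p^'p"
where
  "M_mat c grp rho w X A r s T lam =
     (\<chi> i l. case c l of
        Inl j \<Rightarrow> (gram X *v eta_vec rho (block grp j s)) $ i
      | Inr k \<Rightarrow> ((r_circ_gram grp r X ** D_mat grp rho A s + lam *\<^sub>R weight_mat grp w) ** T) $ i $ k)"

end

theory Submission
  imports Defs
begin

text \<open>
  By Hoelder duality, \<open>(b, s)\<close> is an estimator-subgradient pair for some response iff \<open>\<parallel>s\<^sub>(\<^sub>j\<^sub>)\<parallel> \<le> 1\<close> in
  the dual norm and \<open>b\<^sub>(\<^sub>j\<^sub>) \<bullet> s\<^sub>(\<^sub>j\<^sub>) = \<parallel>b\<^sub>(\<^sub>j\<^sub>)\<parallel>\<close> for all \<open>j\<close>, and then \<open>b\<^sub>(\<^sub>j\<^sub>) = \<parallel>b\<^sub>(\<^sub>j\<^sub>)\<parallel> \<eta>(s\<^sub>(\<^sub>j\<^sub>))\<close>. The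
  pair is unique by monotonicity of the subgradient, so the event in question is \<open>U \<in> G(Dom)\<close> for the
  injective map \<open>G(r, u) = H\<^sub>A(r, s(u))\<close>, and its probability follows from the change of variables
  formula. Only the points with \<open>s\<^sub>k(u) = 0\<close> for an active coordinate \<open>k\<close> obstruct differentiability (if
  \<open>\<rho> < 1\<close>). At such a point \<open>k \<in> F\<close>, since the tangent space of the subgradient space contains the
  \<open>k\<close>-th unit vector; hence these points lie in the hyperplanes \<open>u\<^sub>k = 0\<close>, and as \<open>\<eta>(u\<^sub>k)\<close> is constant on
  them, they and their image under \<open>G\<close> are null sets.
\<close>

subsection \<open>The \<open>\<ell>\<^sub>p\<close>-norm and its duality map\<close>

text \<open>The functions \<open>\<beta>hat\<close> and \<open>S\<close> are given only pointwise,
  so measurability of the event is part of the claim. It rests on a quantitative form of uniqueness: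
  \<open>X\<close> is injective, hence the Gram matrix is bounded below, and monotonicity of the
  subgradient makes the estimator a Lipschitz function of \<open>U\<close>; \<open>S\<close> is then
  solved for in its defining equation. The image of \<open>Dom\<close> under \<open>G\<close> is
  only known to be Lebesgue measurable, so the density formula for \<open>U\<close> has to be
  extended from Borel sets to such sets. Cutting the non-smooth points out of \<open>Dom\<close> is
  harmless for the integral, but their image must be shown null although \<open>G\<close> need not
  be differentiable there. The remedy is to split \<open>Dom\<close> by the set of active
  coordinates at which \<open>s\<close> vanishes. Within one piece \<open>G\<close> is
  differentiable for every \<open>\<rho>\<close>, and a derivative within a set is all that the
  results on null images, measurable images and change of variables ask for.\<close>

lemma eta_abs: "\<bar>eta a x\<bar> = \<bar>x\<bar> powr a"
  by (auto simp: eta_def abs_mult sgn_if)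

lemma eta_0 [simp]: "eta a 0 = 0"
  by (simp add: eta_def)

lemma mult_eta: "x * eta a x = \<bar>x\<bar> powr (a + 1)"
  by (cases "x = 0") (auto simp: eta_def sgn_if powr_add abs_if)

lemma eta_eta: "eta a (eta b x) = eta (a * b) x"
  by (cases x "0 :: real" rule: linorder_cases) (auto simp: eta_def sgn_if powr_powr mult.commute)

lemma eta_1 [simp]: "eta 1 x = x"
  by (auto simp: eta_def sgn_if)

lemma eta_eq_0_iff [simp]: "eta a x = 0 \<longleftrightarrow> x = 0"
  by (auto simp: eta_def sgn_if)

text \<open>At 0 the difference quotient in \<open>h\<close> is \<open>eta (a - 1) h\<close>, which
  tends to 0 because \<open>a > 1\<close>; elsewhere the function is locally a smooth power of
  \<open>x\<close> or \<open>- x\<close>.\<close>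

lemma has_field_derivative_abs_powr:
  fixes x :: real
  assumes "1 < a"
  shows "((\<lambda>x. \<bar>x\<bar> powr a) has_field_derivative a * eta (a - 1) x) (at x)"
proof (cases x "0 :: real" rule: linorder_cases)
  case less
  have "((\<lambda>x. (- x) powr a) has_field_derivative a * eta (a - 1) x) (at x)"
    using less by (auto intro!: derivative_eq_intros simp: eta_def)
  moreover have "\<forall>\<^sub>F x in nhds x. (- x) powr a = \<bar>x\<bar> powr a"
    using eventually_nhds_in_open[of "{..<0}" x] less by (auto elim: eventually_mono)
  ultimately show ?thesis
    by (subst (asm) DERIV_cong_ev[OF refl _ refl])
next
  case greater
  have "((\<lambda>x. x powr a) has_field_derivative a * eta (a - 1) x) (at x)"
    using greater by (auto intro!: derivative_eq_intros simp: eta_def)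
  moreover have "\<forall>\<^sub>F x in nhds x. x powr a = \<bar>x\<bar> powr a"
    using eventually_nhds_in_open[of "{0<..}" x] greater by (auto elim: eventually_mono)
  ultimately show ?thesis
    by (subst (asm) DERIV_cong_ev[OF refl _ refl])
next
  case equal
  have "((\<lambda>h :: real. \<bar>h\<bar> powr (a - 1)) \<longlongrightarrow> \<bar>0\<bar> powr (a - 1)) (at 0)"
    by (rule tendsto_powr2) (use assms in \<open>auto intro!: tendsto_eq_intros\<close>)
  then have "((\<lambda>h :: real. eta (a - 1) h) \<longlongrightarrow> 0) (at 0)"
    using assms by (subst tendsto_rabs_zero_iff[symmetric]) (simp add: eta_abs)
  moreover have "\<bar>h\<bar> powr a / h = eta (a - 1) h" if "h \<noteq> 0" for h :: real
    using mult_eta[of h "a - 1"] that by (simp add: field_simps)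
  ultimately have "((\<lambda>h :: real. \<bar>h\<bar> powr a / h) \<longlongrightarrow> 0) (at 0)"
    by (subst tendsto_cong[where g = "eta (a - 1)"]) (auto simp: eventually_at_filter)
  then show ?thesis
    using equal assms by (simp add: DERIV_def)
qed

lemma has_field_derivative_eta:
  assumes "x \<noteq> 0"
  shows "(eta a has_field_derivative eta' a x) (at x)"
proof (cases "a = 1")
  case True
  have "eta 1 = (\<lambda>x. x)" "eta' 1 x = 1"
    by (simp_all add: fun_eq_iff eta'_def)
  with True show ?thesis
    by (simp add: DERIV_ident)
next
  case a: False
  show ?thesis
  proof (cases x "0 :: real" rule: linorder_cases)
    case less
    have "((\<lambda>x. - ((- x) powr a)) has_field_derivative eta' a x) (at x)"
      using less a by (auto intro!: derivative_eq_intros simp: eta'_def)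
    moreover have "\<forall>\<^sub>F x in nhds x. - ((- x) powr a) = eta a x"
      using eventually_nhds_in_open[of "{..<0}" x] less by (auto elim!: eventually_mono simp: eta_def)
    ultimately show ?thesis
      by (subst (asm) DERIV_cong_ev[OF refl _ refl])
  next
    case greater
    have "((\<lambda>x. x powr a) has_field_derivative eta' a x) (at x)"
      using greater a by (auto intro!: derivative_eq_intros simp: eta'_def)
    moreover have "\<forall>\<^sub>F x in nhds x. x powr a = eta a x"
      using eventually_nhds_in_open[of "{0<..}" x] greater by (auto elim!: eventually_mono simp: eta_def)
    ultimately show ?thesis
      by (subst (asm) DERIV_cong_ev[OF refl _ refl])
  qed (use assms in simp)
qed

lemma borel_measurable_eta [measurable]: "eta a \<in> borel_measurable borel"
  unfolding eta_def [abs_def] by measurable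

lemma borel_measurable_eta' [measurable]: "eta' a \<in> borel_measurable borel"
  unfolding eta'_def [abs_def] by measurable

lemma lp_norm_nonneg [simp]: "0 \<le> lp_norm a x"
  by (simp add: lp_norm_def)

lemma lp_norm_powr: "0 < a \<Longrightarrow> lp_norm a x powr a = (\<Sum>k\<in>UNIV. \<bar>x $ k\<bar> powr a)"
  by (simp add: lp_norm_def powr_powr sum_nonneg)

lemma lp_norm_le_1_iff: "0 < a \<Longrightarrow> lp_norm a x \<le> 1 \<longleftrightarrow> (\<Sum>k\<in>UNIV. \<bar>x $ k\<bar> powr a) \<le> 1"
  using powr_mono2[of a "lp_norm a x" 1] powr_less_mono2[of a 1 "lp_norm a x"] lp_norm_powr[of a x]
  by fastforce

lemma lp_norm_eq_1_iff: "0 < a \<Longrightarrow> lp_norm a x = 1 \<longleftrightarrow> (\<Sum>k\<in>UNIV. \<bar>x $ k\<bar> powr a) = 1"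
  by (metis lp_norm_def lp_norm_powr powr_one_eq_one)

lemma lp_norm_0 [simp]: "lp_norm a 0 = 0"
  by (simp add: lp_norm_def)

lemma lp_norm_eq_0_iff [simp]: "0 < a \<Longrightarrow> lp_norm a x = 0 \<longleftrightarrow> x = 0"
  by (auto simp: lp_norm_def sum_nonneg_eq_0_iff vec_eq_iff)

lemma lp_norm_scaleR:
  assumes "0 < a"
  shows "lp_norm a (c *\<^sub>R x) = \<bar>c\<bar> * lp_norm a x"
proof -
  have "(\<Sum>k\<in>UNIV. \<bar>(c *\<^sub>R x) $ k\<bar> powr a) = \<bar>c\<bar> powr a * (\<Sum>k\<in>UNIV. \<bar>x $ k\<bar> powr a)"
    by (simp add: abs_mult powr_mult sum_distrib_left)
  then show ?thesis
    using assms by (simp add: lp_norm_def powr_mult sum_nonneg powr_powr)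
qed

lemma borel_measurable_lp_norm [measurable]: "lp_norm a \<in> borel_measurable borel"
  unfolding lp_norm_def [abs_def] by measurable

section \<open>Hoelder duality between conjugate exponents\<close>

locale conjugate_exponents =
  fixes p q :: real
  assumes p_gt_1: "1 < p" and conj: "1 / p + 1 / q = 1"
begin

lemma q_gt_1: "1 < q"
proof -
  have "1 / q = 1 - 1 / p" "0 < 1 - 1 / p" "1 - 1 / p < 1"
    using conj p_gt_1 by auto
  then show ?thesis
    by (metis divide_less_eq_1_pos zero_less_divide_1_iff)
qed

lemma add_eq_mult: "p + q = p * q"
  using conj p_gt_1 q_gt_1 by (simp add: field_simps)

lemma div_eq: "q / p = q - 1"
  using p_gt_1 add_eq_mult by (simp add: field_simps)

lemma diff_mult_eq: "(q - 1) * p = q" "(p - 1) * (q - 1) = 1"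
  using add_eq_mult by (simp_all add: algebra_simps)

text \<open>Interpreting the locale a second time along this fact gives each result with the roles
  of the two exponents exchanged.\<close>

lemma swap: "conjugate_exponents q p"
  using q_gt_1 conj by unfold_locales auto

lemma Young: "x * y \<le> \<bar>x\<bar> powr p / p + \<bar>y\<bar> powr q / q"
proof -
  have "x * y \<le> \<bar>x\<bar> * \<bar>y\<bar>"
    by (simp add: abs_mult[symmetric])
  also have "\<dots> \<le> \<bar>x\<bar> powr p / p + \<bar>y\<bar> powr q / q"
    using Youngs_inequality[OF p_gt_1 q_gt_1 conj, of "\<bar>x\<bar>" "\<bar>y\<bar>"] by simp
  finally show ?thesis .
qed

text \<open>Equality at \<open>x\<close> makes \<open>x\<close> a global minimum of the Young gap as
  a function of its first argument. The derivative vanishes there, so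
  \<open>eta (p - 1) x = y\<close>, and \<open>eta (q - 1)\<close> inverts this because
  \<open>(p - 1) * (q - 1) = 1\<close>.\<close>

lemma Young_eq:
  assumes "x * y = \<bar>x\<bar> powr p / p + \<bar>y\<bar> powr q / q"
  shows "x = eta (q - 1) y"
proof -
  define f where "f = (\<lambda>t. \<bar>t\<bar> powr p / p - t * y)"
  have "(f has_field_derivative eta (p - 1) x - y) (at x)"
    using DERIV_diff[OF DERIV_cdivide[OF has_field_derivative_abs_powr[OF p_gt_1, of x], of p]
        DERIV_cmult_right[OF DERIV_ident, of y]] p_gt_1
    by (simp add: f_def mult.commute)
  moreover have "f x \<le> f t" for t
    using Young[of t y] assms by (simp add: f_def)
  ultimately have "eta (p - 1) x - y = 0"
    by (intro DERIV_local_min[of f _ x 1]) auto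
  then have "eta (q - 1) y = eta ((q - 1) * (p - 1)) x"
    by (simp flip: eta_eta)
  then show ?thesis
    using diff_mult_eq(2) by (simp add: mult.commute)
qed

lemma inner_le_Young:
  assumes "lp_norm p x \<le> 1" "lp_norm q y \<le> 1"
  shows "x \<bullet> y \<le> 1"
proof -
  have "x \<bullet> y \<le> (\<Sum>k\<in>UNIV. \<bar>x $ k\<bar> powr p) / p + (\<Sum>k\<in>UNIV. \<bar>y $ k\<bar> powr q) / q"
    unfolding inner_vec_def sum_divide_distrib sum.distrib[symmetric]
    by (intro sum_mono) (simp add: Young)
  also have "\<dots> \<le> 1 / p + 1 / q"
    using assms p_gt_1 q_gt_1 by (intro add_mono divide_right_mono) (auto simp: lp_norm_le_1_iff)
  finally show ?thesis
    by (simp add: conj)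
qed

lemma inner_le_lp_norm:
  assumes "lp_norm q y \<le> 1"
  shows "x \<bullet> y \<le> lp_norm p x"
proof (cases "x = 0")
  case False
  then have "0 < lp_norm p x"
    using p_gt_1 lp_norm_nonneg[of p x] by (simp add: less_le)
  moreover have "(x /\<^sub>R lp_norm p x) \<bullet> y \<le> 1"
    using calculation p_gt_1 assms by (intro inner_le_Young) (auto simp: lp_norm_scaleR field_simps)
  ultimately show ?thesis
    by (simp add: field_simps)
qed simp

text \<open>\<open>eta_vec (q / p)\<close> is the duality map from the \<open>q\<close>-sphere to
  the \<open>p\<close>-sphere: both \<open>\<bar>eta (q / p) x\<bar> powr p\<close> and
  \<open>x * eta (q / p) x\<close> equal \<open>\<bar>x\<bar> powr q\<close>, the latter since
  \<open>q / p = q - 1\<close>.\<close>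

lemma lp_norm_eta_vec:
  assumes "lp_norm q s = 1"
  shows "lp_norm p (eta_vec (q / p) s) = 1" "eta_vec (q / p) s \<bullet> s = 1"
proof -
  have *: "(\<Sum>k\<in>UNIV. \<bar>s $ k\<bar> powr q) = 1"
    using assms q_gt_1 by (simp add: lp_norm_eq_1_iff)
  show "lp_norm p (eta_vec (q / p) s) = 1"
    using p_gt_1 * by (simp add: lp_norm_eq_1_iff eta_vec_def eta_abs powr_powr)
  show "eta_vec (q / p) s \<bullet> s = 1"
    using * by (simp add: eta_vec_def inner_vec_def mult.commute[of _ "s $ _"] mult_eta div_eq)
qed

text \<open>Equality in Hoelder's inequality forces equality in Young's inequality in every coordinate.\<close>

lemma eq_eta_vec_of_inner_eq:
  assumes s: "lp_norm q s \<le> 1" and eq: "b \<bullet> s = lp_norm p b" and "b \<noteq> 0"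
  shows "lp_norm q s = 1" "b = lp_norm p b *\<^sub>R eta_vec (q / p) s"
proof -
  define x where "x = b /\<^sub>R lp_norm p b"
  have b: "0 < lp_norm p b"
    using \<open>b \<noteq> 0\<close> p_gt_1 lp_norm_nonneg[of p b] by (simp add: less_le)
  then have x: "(\<Sum>k\<in>UNIV. \<bar>x $ k\<bar> powr p) = 1" and xs: "x \<bullet> s = 1"
    using p_gt_1 lp_norm_eq_1_iff[of p x] \<open>b \<noteq> 0\<close> by (auto simp: x_def lp_norm_scaleR eq)
  have s': "(\<Sum>k\<in>UNIV. \<bar>s $ k\<bar> powr q) \<le> 1"
    using s q_gt_1 by (simp add: lp_norm_le_1_iff)
  \<comment> \<open>The Young gap in coordinate \<open>k\<close>. The gaps are nonnegative and sum
    to at most \<open>1 / p + 1 / q - 1 = 0\<close>; their vanishing gives both the norm of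
    \<open>s\<close> and the formula for \<open>x\<close>.\<close>
  define d where "d = (\<lambda>k. \<bar>x $ k\<bar> powr p / p + \<bar>s $ k\<bar> powr q / q - x $ k * s $ k)"
  have sum_d: "sum d UNIV = 1 / p + (\<Sum>k\<in>UNIV. \<bar>s $ k\<bar> powr q) / q - 1"
    using x xs by (simp add: d_def sum.distrib sum_subtractf sum_divide_distrib[symmetric] inner_vec_def)
  have d_nonneg: "0 \<le> d k" for k
    using Young by (simp add: d_def)
  have "(\<Sum>k\<in>UNIV. \<bar>s $ k\<bar> powr q) / q \<le> 1 / q"
    using s' q_gt_1 by (simp add: divide_right_mono)
  then have d0: "sum d UNIV = 0"
    using sum_d conj sum_nonneg[of UNIV d] d_nonneg by simp
  then have "(\<Sum>k\<in>UNIV. \<bar>s $ k\<bar> powr q) / q = 1 / q"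
    using sum_d conj by linarith
  then show "lp_norm q s = 1"
    using q_gt_1 by (simp add: lp_norm_eq_1_iff)
  have "d k = 0" for k
    using d0 d_nonneg by (simp add: sum_nonneg_eq_0_iff)
  then have "x = eta_vec (q / p) s"
    using Young_eq by (simp add: d_def eta_vec_def vec_eq_iff div_eq)
  then show "b = lp_norm p b *\<^sub>R eta_vec (q / p) s"
    using b \<open>b \<noteq> 0\<close> p_gt_1 by (simp add: x_def flip: \<open>x = eta_vec (q / p) s\<close>)
qed

text \<open>The duality map of the normalised \<open>s\<close> attains the supremum that expresses
  the \<open>q\<close>-norm as a dual norm.\<close>

lemma ex_dual:
  obtains x where "lp_norm p x \<le> 1" "x \<bullet> s = lp_norm q s"
proof (cases "s = 0")
  case True
  with that[of 0] q_gt_1 show ?thesis by simp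
next
  case False
  then have pos: "0 < lp_norm q s"
    using q_gt_1 lp_norm_nonneg[of q s] by (simp add: less_le)
  define s' where "s' = s /\<^sub>R lp_norm q s"
  have "lp_norm q s' = 1"
    using False q_gt_1 by (simp add: s'_def lp_norm_scaleR)
  from lp_norm_eta_vec[OF this] pos show ?thesis
    by (intro that[of "eta_vec (q / p) s'"]) (simp_all add: s'_def field_simps)
qed

text \<open>Test \<open>x + y\<close> against its own dual vector and bound the two summands by
  Hoelder. Dual vectors come from \<open>ex_dual\<close> for the exponent \<open>q\<close>; the case
  of \<open>p\<close> follows by \<open>swap\<close>.\<close>

lemma lp_norm_triangle: "lp_norm q (x + y) \<le> lp_norm q x + lp_norm q y"
proof -
  interpret swap: conjugate_exponents q p
    by (rule swap)
  obtain s where s: "lp_norm p s \<le> 1" "s \<bullet> (x + y) = lp_norm q (x + y)"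
    using ex_dual by blast
  have "lp_norm q (x + y) = x \<bullet> s + y \<bullet> s"
    using s(2) by (simp add: inner_add inner_commute)
  also have "\<dots> \<le> lp_norm q x + lp_norm q y"
    using s(1) by (intro add_mono swap.inner_le_lp_norm)
  finally show ?thesis .
qed

lemma lp_norm_le_1I:
  assumes "\<And>x. x \<bullet> s \<le> lp_norm p x"
  shows "lp_norm q s \<le> 1"
proof -
  obtain x where "lp_norm p x \<le> 1" "x \<bullet> s = lp_norm q s"
    using ex_dual by blast
  with assms[of x] show ?thesis by simp
qed

end

subsection \<open>Optimality conditions of the block Lasso\<close>

lemma block_nth [simp]: "block grp j x $ k = (if grp k = j then x $ k else 0)"
  by (simp add: block_def coord_proj_def group_of_def)

lemma block_add: "block grp j (x + y) = block grp j x + block grp j y"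
  by (simp add: vec_eq_iff)

lemma block_diff: "block grp j (x - y) = block grp j x - block grp j y"
  by (simp add: vec_eq_iff)

lemma block_block: "block grp i (block grp j x) = (if i = j then block grp j x else 0)"
  by (auto simp: vec_eq_iff)

lemma inner_block_block: "block grp j x \<bullet> block grp j y = x \<bullet> block grp j y"
  by (auto simp: inner_vec_def intro!: sum.cong)

lemma linear_coord_proj: "linear (coord_proj K)"
  by (rule linearI) (auto simp: coord_proj_def vec_eq_iff)

lemma borel_measurable_coord_proj [measurable]: "coord_proj K \<in> borel_measurable borel"
  by (intro borel_measurable_continuous_onI linear_continuous_on linear_conv_bounded_linear[THEN iffD1] linear_coord_proj)

lemma borel_measurable_block [measurable]: "block grp j \<in> borel_measurable borel"
  unfolding block_def [abs_def] by measurable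

lemma weight_mat_mult_nth [simp]: "(weight_mat grp w *v s) $ k = w $ grp k * s $ k"
  by (simp add: weight_mat_def matrix_vector_mult_def if_distrib[of "\<lambda>x. x * _"] cong: if_cong)

lemma inner_weight_mat:
  fixes grp :: "'p::finite \<Rightarrow> 'j::finite"
  shows "b \<bullet> (weight_mat grp w *v s) = (\<Sum>j\<in>UNIV. w $ j * (block grp j b \<bullet> block grp j s))"
proof -
  have "(\<Sum>j\<in>UNIV. w $ j * (block grp j b \<bullet> block grp j s))
      = (\<Sum>k\<in>UNIV. \<Sum>j\<in>UNIV. if grp k = j then w $ j * (b $ k * s $ k) else 0)"
    unfolding inner_vec_def sum_distrib_left
    by (subst sum.swap) (auto intro!: sum.cong)
  also have "\<dots> = b \<bullet> (weight_mat grp w *v s)"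
    by (simp add: inner_vec_def algebra_simps)
  finally show ?thesis ..
qed

lemma lp_norm_block_le:
  assumes "0 < a"
  shows "lp_norm a (block grp j x) \<le> lp_norm a x"
  unfolding lp_norm_def using assms
  by (intro powr_mono2 sum_mono sum_nonneg) auto

lemma gram_mult: "gram X *v b = (1 / real CARD('n)) *\<^sub>R (transpose X *v (X *v b))"
  for X :: "real^'p^'n"
  by (simp add: gram_def scaleR_matrix_vector_assoc[symmetric] matrix_vector_mul_assoc)

lemma inner_transpose_mult: "x \<bullet> (transpose A *v y) = (A *v x) \<bullet> y"
  for A :: "real^'p^'n"
  by (metis dot_lmul_matrix inner_commute transpose_matrix_vector)

lemma inner_gram: "x \<bullet> (gram X *v x) = (norm (X *v x))\<^sup>2 / real CARD('n)"
  for X :: "real^'p^'n"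
  by (simp add: gram_mult inner_transpose_mult power2_norm_eq_inner del: transpose_matrix_vector)

definition penalty :: "('p::finite \<Rightarrow> 'j::finite) \<Rightarrow> real \<Rightarrow> real^'j \<Rightarrow> real^'p \<Rightarrow> real" where
  "penalty grp a w b = (\<Sum>j\<in>UNIV. w $ j * lp_norm a (block grp j b))"

text \<open>\<open>s\<close> is a blockwise subgradient of the \<open>\<ell>\<^sub>a\<close>-norm at \<open>b\<close>; \<open>a'\<close> is the exponent conjugate to \<open>a\<close>.\<close>

definition dual_pair ::
  "('p::finite \<Rightarrow> 'j::finite) \<Rightarrow> real \<Rightarrow> real \<Rightarrow> real^'p \<Rightarrow> real^'p \<Rightarrow> bool"
where
  "dual_pair grp a a' b s \<longleftrightarrow>
     (\<forall>j. lp_norm a' (block grp j s) \<le> 1 \<and>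
          block grp j b \<bullet> block grp j s = lp_norm a (block grp j b))"

text \<open>Inverts the representation of the estimator: on an active group the coefficients are the
  norm times the duality map of the subgradient.\<close>

definition estimate ::
  "('p::finite \<Rightarrow> 'j::finite) \<Rightarrow> real \<Rightarrow> 'j set \<Rightarrow> real^'j \<Rightarrow> real^'p \<Rightarrow> real^'p"
where
  "estimate grp rho A r s = (\<chi> k. if grp k \<in> A then r $ grp k * eta rho (s $ k) else 0)"

text \<open>Linearity moves the sum inside \<open>gram X\<close>. In this form \<open>H_map\<close>
  is the left side of the equation defining the subgradient, less \<open>gram X *v \<beta>0\<close>,
  so that equation says exactly that \<open>H_map\<close> equals the noise term
  \<open>U\<close>.\<close>

lemma H_map_eq:
  "H_map grp rho w X A r s \<beta>0 lam =
     gram X *v estimate grp rho A r s + lam *\<^sub>R (weight_mat grp w *v s) - gram X *v \<beta>0"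
proof -
  have "estimate grp rho A r s = (\<Sum>j\<in>A. r $ j *\<^sub>R eta_vec rho (block grp j s))"
    by (auto simp: vec_eq_iff estimate_def eta_vec_def if_distrib[of "\<lambda>x. _ * x"]
        if_distrib[of "eta _"] cong: if_cong)
  then show ?thesis
    by (simp add: H_map_def matrix_vector_mult_scaleR linear_sum[OF matrix_vector_mul_linear])
qed

context conjugate_exponents
begin

text \<open>Monotonicity of the subdifferential, block by block: pairing \<open>b\<close> with its
  own subgradient gives its norm, pairing it with any other vector of the dual ball gives at most
  that.\<close>

lemma dual_pair_monotone:
  fixes grp :: "'p::finite \<Rightarrow> 'j::finite"
  assumes w: "\<forall>j. 0 < w $ j"
    and 1: "dual_pair grp p q b s" and 2: "dual_pair grp p q b' s'"
  shows "0 \<le> (b - b') \<bullet> (weight_mat grp w *v s - weight_mat grp w *v s')"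
proof -
  let ?B = "block grp"
  have "(b - b') \<bullet> (weight_mat grp w *v s - weight_mat grp w *v s')
     = (\<Sum>j\<in>UNIV. w $ j * ((?B j b \<bullet> ?B j s - ?B j b \<bullet> ?B j s') + (?B j b' \<bullet> ?B j s' - ?B j b' \<bullet> ?B j s)))"
    unfolding inner_diff inner_weight_mat sum_subtractf[symmetric]
    by (intro sum.cong) (auto simp: block_diff algebra_simps)
  also have "\<dots> \<ge> 0"
  proof (intro sum_nonneg mult_nonneg_nonneg add_nonneg_nonneg)
    fix j
    show "0 \<le> ?B j b \<bullet> ?B j s - ?B j b \<bullet> ?B j s'" "0 \<le> ?B j b' \<bullet> ?B j s' - ?B j b' \<bullet> ?B j s"
      using 1 2 by (auto simp: dual_pair_def intro: inner_le_lp_norm)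
  qed (use w in \<open>simp add: less_imp_le\<close>)
  finally show ?thesis .
qed

text \<open>On an active block the equality case of Hoelder applies; on an inactive one both sides
  of the representation are 0.\<close>

lemma dual_pair_subgrad_space:
  fixes grp :: "'p::finite \<Rightarrow> 'j::finite"
  assumes "dual_pair grp p q b s"
  shows "s \<in> subgrad_space grp q (active_set grp b)"
    and "b = estimate grp (q / p) (active_set grp b) (coord_proj (active_set grp b) (block_norms grp p b)) s"
proof -
  have *: "lp_norm q (block grp j s) = 1"
      "block grp j b = lp_norm p (block grp j b) *\<^sub>R eta_vec (q / p) (block grp j s)"
    if "block grp j b \<noteq> 0" for j
    using eq_eta_vec_of_inner_eq[of "block grp j s" "block grp j b"] assms that
    by (auto simp: dual_pair_def)
  then show "s \<in> subgrad_space grp q (active_set grp b)"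
    using assms by (auto simp: subgrad_space_def active_set_def dual_pair_def)
  show "b = estimate grp (q / p) (active_set grp b) (coord_proj (active_set grp b) (block_norms grp p b)) s"
  proof (subst vec_eq_iff, rule allI)
    fix k
    show "b $ k = estimate grp (q / p) (active_set grp b) (coord_proj (active_set grp b) (block_norms grp p b)) s $ k"
    proof (cases "block grp (grp k) b = 0")
      case True
      moreover from True have "b $ k = 0"
        by (simp only: vec_eq_iff block_nth zero_index) metis
      ultimately show ?thesis
        by (simp add: estimate_def active_set_def)
    next
      case False
      have "block grp (grp k) b $ k = (lp_norm p (block grp (grp k) b) *\<^sub>R eta_vec (q / p) (block grp (grp k) s)) $ k"
        using *(2)[OF False] by metis
      with False show ?thesis
        by (simp add: estimate_def active_set_def coord_proj_def block_norms_def eta_vec_def)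
    qed
  qed
qed

text \<open>The converse of \<open>dual_pair_subgrad_space\<close>. The duality map lands on the
  unit sphere, so \<open>r\<close> reappears as the vector of block norms. Together the two lemmas
  put the points \<open>(r, s)\<close> over \<open>A\<close> in bijection with the dual pairs whose
  active set is \<open>A\<close>.\<close>

lemma estimate_dual_pair:
  fixes grp :: "'p::finite \<Rightarrow> 'j::finite"
  assumes s: "s \<in> subgrad_space grp q A" and r: "r \<in> coord_space A" "\<forall>j\<in>A. 0 < r $ j"
  defines "b \<equiv> estimate grp (q / p) A r s"
  shows "dual_pair grp p q b s" "active_set grp b = A" "coord_proj A (block_norms grp p b) = r"
proof -
  have in_A: "block grp j b = r $ j *\<^sub>R eta_vec (q / p) (block grp j s)"
      "lp_norm q (block grp j s) = 1" if "j \<in> A" for j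
    using that s by (auto simp: vec_eq_iff b_def estimate_def eta_vec_def subgrad_space_def)
  have not_in_A: "block grp j b = 0" "lp_norm q (block grp j s) \<le> 1" if "j \<notin> A" for j
    using that s by (auto simp: vec_eq_iff b_def estimate_def subgrad_space_def)
  have norm: "lp_norm p (block grp j b) = r $ j" if "j \<in> A" for j
    using in_A[OF that] r(2) that p_gt_1 lp_norm_eta_vec(1)[of "block grp j s"]
    by (simp add: lp_norm_scaleR less_imp_le)
  show "dual_pair grp p q b s"
    unfolding dual_pair_def
  proof (intro allI)
    fix j
    show "lp_norm q (block grp j s) \<le> 1 \<and> block grp j b \<bullet> block grp j s = lp_norm p (block grp j b)"
      using in_A[of j] not_in_A[of j] norm[of j] lp_norm_eta_vec(2)[of "block grp j s"]
      by (cases "j \<in> A") auto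
  qed
  have "block grp j b \<noteq> 0 \<longleftrightarrow> j \<in> A" for j
    using norm[of j] not_in_A(1)[of j] r(2) p_gt_1 by force
  then show "active_set grp b = A"
    by (auto simp: active_set_def)
  show "coord_proj A (block_norms grp p b) = r"
    using norm r(1) by (simp add: coord_proj_def block_norms_def vec_eq_iff coord_space_def)
qed

section \<open>Convexity of the penalty, first-order optimality and stability\<close>

lemma penalty_convex:
  fixes grp :: "'p::finite \<Rightarrow> 'j::finite"
  assumes w: "\<forall>j. 0 < w $ j" and t: "0 \<le> t" "t \<le> 1"
  shows "penalty grp p w (b + t *\<^sub>R h) \<le> penalty grp p w b + t * (penalty grp p w (b + h) - penalty grp p w b)"
proof -
  interpret swap: conjugate_exponents q p
    by (rule swap)
  have "lp_norm p (block grp j (b + t *\<^sub>R h))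
      \<le> (1 - t) * lp_norm p (block grp j b) + t * lp_norm p (block grp j (b + h))" for j
  proof -
    have "block grp j (b + t *\<^sub>R h) = (1 - t) *\<^sub>R block grp j b + t *\<^sub>R block grp j (b + h)"
      by (simp add: vec_eq_iff algebra_simps)
    then have "lp_norm p (block grp j (b + t *\<^sub>R h))
        \<le> lp_norm p ((1 - t) *\<^sub>R block grp j b) + lp_norm p (t *\<^sub>R block grp j (b + h))"
      using swap.lp_norm_triangle by metis
    then show ?thesis
      using t p_gt_1 by (simp add: lp_norm_scaleR)
  qed
  then have "penalty grp p w (b + t *\<^sub>R h)
      \<le> (\<Sum>j\<in>UNIV. w $ j * ((1 - t) * lp_norm p (block grp j b) + t * lp_norm p (block grp j (b + h))))"
    unfolding penalty_def by (intro sum_mono mult_left_mono) (use w in \<open>auto simp: less_imp_le\<close>)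
  also have "\<dots> = penalty grp p w b + t * (penalty grp p w (b + h) - penalty grp p w b)"
    by (simp add: penalty_def sum_distrib_left sum.distrib[symmetric] sum_subtractf[symmetric] algebra_simps)
  finally show ?thesis .
qed

text \<open>A subgradient of the weighted sum splits into blockwise subgradients, since an increment
  supported on one block changes only that block's norm. The triangle inequality then bounds the
  dual norm by 1, and the increment that cancels the block yields the inequality opposite to
  Hoelder.\<close>

lemma dual_pairI:
  fixes grp :: "'p::finite \<Rightarrow> 'j::finite"
  assumes w: "\<forall>j. 0 < w $ j"
    and subgradient: "\<And>h. h \<bullet> (weight_mat grp w *v s) \<le> penalty grp p w (b + h) - penalty grp p w b"
  shows "dual_pair grp p q b s"
proof -
  interpret swap: conjugate_exponents q p
    by (rule swap)
  have *: "x \<bullet> block grp j s \<le> lp_norm p (block grp j b + block grp j x) - lp_norm p (block grp j b)" for j x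
  proof -
    have "w $ j * (x \<bullet> block grp j s) = block grp j x \<bullet> (weight_mat grp w *v s)"
      by (simp add: inner_weight_mat block_block if_distrib[of "\<lambda>x. x \<bullet> _"] inner_block_block if_distrib[of "\<lambda>x. _ * x"]
          cong: if_cong)
    also have "\<dots> \<le> (\<Sum>i\<in>UNIV. w $ i * (lp_norm p (block grp i (b + block grp j x)) - lp_norm p (block grp i b)))"
      using subgradient[of "block grp j x"]
      by (simp add: penalty_def sum_subtractf algebra_simps)
    also have "\<dots> = (\<Sum>i\<in>UNIV. if i = j
        then w $ j * (lp_norm p (block grp j b + block grp j x) - lp_norm p (block grp j b)) else 0)"
      by (intro sum.cong) (auto simp: block_add block_block)
    finally show ?thesis
      using w by simp
  qed
  show ?thesis
    unfolding dual_pair_def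
  proof (intro allI conjI)
    fix j
    show le_1: "lp_norm q (block grp j s) \<le> 1"
    proof (rule lp_norm_le_1I)
      fix x
      have "x \<bullet> block grp j s \<le> lp_norm p (block grp j x)"
        using *[of x j] swap.lp_norm_triangle[of "block grp j b" "block grp j x"] by simp
      also have "\<dots> \<le> lp_norm p x"
        using p_gt_1 by (intro lp_norm_block_le) simp
      finally show "x \<bullet> block grp j s \<le> lp_norm p x" .
    qed
    have "block grp j b + block grp j (- b) = 0"
      by (simp add: vec_eq_iff)
    with *[of "- b" j] have "lp_norm p (block grp j b) \<le> block grp j b \<bullet> block grp j s"
      by (simp add: inner_block_block)
    with inner_le_lp_norm[OF le_1]
    show "block grp j b \<bullet> block grp j s = lp_norm p (block grp j b)"
      by (simp add: antisym)
  qed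
qed

text \<open>The penalty need not be differentiable at \<open>b\<close>, so \<open>b\<close> is
  compared with \<open>b + t *\<^sub>R h\<close> for small \<open>t > 0\<close>: convexity bounds
  the increment of the penalty linearly in \<open>t\<close>, and the square contributes a term of
  order \<open>t\<close> and one of order \<open>t\<^sup>2\<close>.\<close>

lemma block_lasso_dual_pair:
  fixes grp :: "'p::finite \<Rightarrow> 'j::finite" and X :: "real^'p^'n"
  assumes w: "\<forall>j. 0 < w $ j" and lam: "0 < lam"
    and lasso: "block_lasso grp p w lam X y b" and sub: "lasso_subgradient grp w lam X y b s"
  shows "dual_pair grp p q b s"
proof (rule dual_pairI[OF w])
  fix h
  let ?n = "real CARD('n)"
  define e where "e = y - X *v b"
  \<comment> \<open>The increment of the objective is at most \<open>t * (K + t * C)\<close>.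
    Minimality and \<open>t\<close> tending to 0 give \<open>0 \<le> K\<close>, which is
    \<open>lam\<close> times the subgradient inequality once \<open>e_h\<close> rewrites the
    residual term.\<close>
  define K where "K = lam * (penalty grp p w (b + h) - penalty grp p w b) - (e \<bullet> (X *v h)) / ?n"
  define C where "C = (norm (X *v h))\<^sup>2 / (2 * ?n)"
  have "(1 / ?n) *\<^sub>R (transpose X *v e) = lam *\<^sub>R (weight_mat grp w *v s)"
    using sub unfolding lasso_subgradient_def e_def gram_mult
    by (simp add: matrix_vector_mult_diff_distrib scaleR_diff_right algebra_simps)
  then have "h \<bullet> ((1 / ?n) *\<^sub>R (transpose X *v e)) = lam * (h \<bullet> (weight_mat grp w *v s))"
    by simp
  then have e_h: "(e \<bullet> (X *v h)) / ?n = lam * (h \<bullet> (weight_mat grp w *v s))"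
    by (simp add: inner_transpose_mult inner_commute del: transpose_matrix_vector)
  have K_C: "0 \<le> K + t * C" if t: "0 < t" "t \<le> 1" for t
  proof -
    have "lasso_objective grp p w lam X y b \<le> lasso_objective grp p w lam X y (b + t *\<^sub>R h)"
      using lasso by (simp add: block_lasso_def is_arg_min_linorder)
    moreover have "y - X *v (b + t *\<^sub>R h) = e - t *\<^sub>R (X *v h)"
      by (simp add: e_def matrix_vector_right_distrib matrix_vector_mult_scaleR)
    moreover have "(norm (e - t *\<^sub>R (X *v h)))\<^sup>2 = (norm e)\<^sup>2 - 2 * t * (e \<bullet> (X *v h)) + t\<^sup>2 * (norm (X *v h))\<^sup>2"
      unfolding power2_norm_eq_inner
      by (simp add: inner_diff inner_commute power2_eq_square algebra_simps)
    ultimately have "1 / (2 * ?n) * (norm e)\<^sup>2 + lam * penalty grp p w b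
        \<le> 1 / (2 * ?n) * ((norm e)\<^sup>2 - 2 * t * (e \<bullet> (X *v h)) + t\<^sup>2 * (norm (X *v h))\<^sup>2)
          + lam * penalty grp p w (b + t *\<^sub>R h)"
      by (simp add: lasso_objective_def penalty_def e_def)
    also have "\<dots> \<le> 1 / (2 * ?n) * ((norm e)\<^sup>2 - 2 * t * (e \<bullet> (X *v h)) + t\<^sup>2 * (norm (X *v h))\<^sup>2)
          + lam * (penalty grp p w b + t * (penalty grp p w (b + h) - penalty grp p w b))"
      using penalty_convex[OF w, of t grp b h] t lam by simp
    also have "1 / (2 * ?n) * ((norm e)\<^sup>2 - 2 * t * (e \<bullet> (X *v h)) + t\<^sup>2 * (norm (X *v h))\<^sup>2)
        = 1 / (2 * ?n) * (norm e)\<^sup>2 - t * ((e \<bullet> (X *v h)) / ?n) + t * (t * C)"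
      by (simp add: C_def power2_eq_square add_divide_distrib diff_divide_distrib)
    finally have "0 \<le> t * (K + t * C)"
      by (simp add: K_def algebra_simps)
    then show ?thesis
      using t by (simp add: zero_le_mult_iff)
  qed
  have "((\<lambda>t. K + t * C) \<longlongrightarrow> K + 0 * C) (at_right 0)"
    by (intro tendsto_intros)
  moreover have "\<forall>\<^sub>F t in at_right 0. 0 \<le> K + t * C"
    using eventually_at_right_real[of 0 1] by (auto elim!: eventually_mono intro: K_C)
  ultimately have "0 \<le> K"
    using tendsto_lowerbound[of "\<lambda>t. K + t * C" K "at_right 0" 0] by simp
  then have "lam * (h \<bullet> (weight_mat grp w *v s)) \<le> lam * (penalty grp p w (b + h) - penalty grp p w b)"
    by (simp add: K_def e_h)
  then show "h \<bullet> (weight_mat grp w *v s) \<le> penalty grp p w (b + h) - penalty grp p w b"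
    using lam by simp
qed

text \<open>Pair the difference of the two left sides with \<open>b - b'\<close>: the subgradient
  part is nonnegative, the Gram part is at least \<open>c\<close> times the squared norm, and
  Cauchy-Schwarz finishes. The constant depends on \<open>X\<close> alone. The quantitative form
  gives measurability of the estimator as well as uniqueness.\<close>

lemma dual_pair_stability:
  fixes X :: "real^'p^'n"
  assumes "rank X = CARD('p)"
  obtains c where "0 < c"
    "\<And>(grp :: 'p \<Rightarrow> 'j::finite) w lam b s b' s'. \<forall>j. 0 < w $ j \<Longrightarrow> 0 < lam \<Longrightarrow>
       dual_pair grp p q b s \<Longrightarrow> dual_pair grp p q b' s' \<Longrightarrow>
       c * norm (b - b') \<le> norm ((gram X *v b + lam *\<^sub>R (weight_mat grp w *v s))
                                - (gram X *v b' + lam *\<^sub>R (weight_mat grp w *v s')))"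
proof -
  have "inj ((*v) X)"
    using assms full_rank_injective by blast
  then obtain B where B: "0 < B" "\<And>x. B * norm x \<le> norm (X *v x)"
    using linear_inj_bounded_below_pos[of "(*v) X"] by auto
  define c where "c = B\<^sup>2 / real CARD('n)"
  show ?thesis
  proof (rule that)
    show c: "0 < c"
      using B by (simp add: c_def)
    fix grp :: "'p \<Rightarrow> 'j::finite" and w :: "real^'j" and lam :: real and b s b' s' :: "real^'p"
    assume w: "\<forall>j. 0 < w $ j" and lam: "0 < lam"
      and 1: "dual_pair grp p q b s" and 2: "dual_pair grp p q b' s'"
    let ?d = "b - b'"
    let ?v = "(gram X *v b + lam *\<^sub>R (weight_mat grp w *v s)) - (gram X *v b' + lam *\<^sub>R (weight_mat grp w *v s'))"
    have "c * (norm ?d)\<^sup>2 \<le> (norm (X *v ?d))\<^sup>2 / real CARD('n)"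
      using B(1) power_mono[OF B(2), of ?d 2] by (simp add: c_def power_mult_distrib divide_right_mono)
    also have "\<dots> = ?d \<bullet> (gram X *v ?d)"
      by (rule inner_gram[symmetric])
    also have "\<dots> \<le> ?d \<bullet> (gram X *v ?d) + lam * (?d \<bullet> (weight_mat grp w *v s - weight_mat grp w *v s'))"
      using dual_pair_monotone[OF w 1 2] lam by simp
    also have "\<dots> = ?d \<bullet> ?v"
      by (simp add: inner_diff inner_add matrix_vector_mult_diff_distrib algebra_simps)
    also have "\<dots> \<le> norm ?d * norm ?v"
      by (rule norm_cauchy_schwarz)
    finally have "norm ?d * (c * norm ?d) \<le> norm ?d * norm ?v"
      by (simp add: power2_eq_square algebra_simps)
    then show "c * norm ?d \<le> norm ?v"
      by (cases "?d = 0") auto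
  qed
qed

lemma dual_pair_unique:
  fixes X :: "real^'p^'n" and grp :: "'p \<Rightarrow> 'j::finite"
  assumes rank: "rank X = CARD('p)" and w: "\<forall>j. 0 < w $ j" and lam: "0 < lam"
    and 1: "dual_pair grp p q b s" and 2: "dual_pair grp p q b' s'"
    and eq: "gram X *v b + lam *\<^sub>R (weight_mat grp w *v s) = gram X *v b' + lam *\<^sub>R (weight_mat grp w *v s')"
  shows "b = b'" "s = s'"
proof -
  from dual_pair_stability[OF rank] obtain c where "0 < c"
    "\<And>b s b' s'. dual_pair grp p q b s \<Longrightarrow> dual_pair grp p q b' s' \<Longrightarrow>
       c * norm (b - b') \<le> norm ((gram X *v b + lam *\<^sub>R (weight_mat grp w *v s))
                                - (gram X *v b' + lam *\<^sub>R (weight_mat grp w *v s')))"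
    using w lam by metis
  from this(1) this(2)[OF 1 2] show b: "b = b'"
    by (simp add: eq mult_le_0_iff)
  have "weight_mat grp w *v s = weight_mat grp w *v s'"
    using eq lam by (simp add: b)
  then have "w $ grp k * s $ k = w $ grp k * s' $ k" for k
    by (metis weight_mat_mult_nth)
  then show "s = s'"
    using w by (simp add: vec_eq_iff) (metis less_irrefl)
qed

end

subsection \<open>Change of variables over an arbitrary finite index type\<close>

text \<open>The library's change of variables formula needs a well-ordered index type.\<close>

typedef 'a well_ordered = "UNIV :: 'a set"
  by simp

text \<open>An arbitrary injection into the naturals. The order pulled back along it carries no
  meaning; it only serves to satisfy the class constraint.\<close>

definition index_rank :: "'a::finite \<Rightarrow> nat" where
  "index_rank = (SOME f. inj f)"

lemma inj_index_rank: "inj (index_rank :: 'a::finite \<Rightarrow> nat)"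
  unfolding index_rank_def
  using finite_imp_inj_to_nat_seg[OF finite_class.finite_UNIV] by (intro someI_ex[of inj]) auto

instance well_ordered :: (finite) finite
proof
  have "(UNIV :: 'a well_ordered set) = range Abs_well_ordered"
    by (metis Rep_well_ordered_inverse surj_def)
  then show "finite (UNIV :: 'a well_ordered set)"
    by (metis finite_class.finite_UNIV finite_imageI)
qed

instantiation well_ordered :: (finite) wellorder
begin

definition "x \<le> y \<longleftrightarrow> index_rank (Rep_well_ordered x) \<le> index_rank (Rep_well_ordered y)"
definition "x < y \<longleftrightarrow> index_rank (Rep_well_ordered x) < index_rank (Rep_well_ordered y)"

instance
proof
  fix x y :: "'a well_ordered"
  show "x = y" if "x \<le> y" "y \<le> x"
    using that by (simp add: less_eq_well_ordered_def inj_eq[OF inj_index_rank] Rep_well_ordered_inject)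
next
  fix P :: "'a well_ordered \<Rightarrow> bool" and a :: "'a well_ordered"
  assume step: "\<And>x. (\<And>y. y < x \<Longrightarrow> P y) \<Longrightarrow> P x"
  show "P a"
  proof (induction a rule: measure_induct_rule[of "\<lambda>x. index_rank (Rep_well_ordered x)"])
    case (less x)
    show ?case
      by (rule step) (simp add: less less_well_ordered_def)
  qed
qed (auto simp: less_eq_well_ordered_def less_well_ordered_def)

end

section \<open>Invariance of determinants and integrals under relabelling of coordinates\<close>

lemma bij_Rep_well_ordered: "bij Rep_well_ordered"
  by (metis bij_betw_def Rep_well_ordered_inject Rep_well_ordered_induct inj_def type_definition.Rep_range type_definition_well_ordered)

text \<open>Conjugation by \<open>f\<close> is a sign-preserving bijection between the two sets of
  permutations and matches the Leibniz sums term by term.\<close>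

lemma det_reindex:
  fixes A :: "real^'p^'p" and f :: "'q::finite \<Rightarrow> 'p"
  assumes f: "bij f"
  shows "det (\<chi> i j. A $ f i $ f j) = det A"
proof -
  have inv: "inv f (f x) = x" "f (inv f y) = y" for x y
    using f by (simp_all add: bij_is_inj bij_is_surj surj_f_inv_f)
  have sign: "sign (f \<circ> p \<circ> inv f) = sign p" and permutes: "(f \<circ> p \<circ> inv f) permutes UNIV"
    if "p permutes UNIV" for p
  proof -
    have "map_permutation UNIV f p = f \<circ> p \<circ> inv f"
      using f by (simp add: map_permutation_def bij_is_surj fun_eq_iff)
    then show "sign (f \<circ> p \<circ> inv f) = sign p" "(f \<circ> p \<circ> inv f) permutes UNIV"
      using sign_map_permutation[of f UNIV p] map_permutation_permutes[of f UNIV UNIV p] f that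
      by (simp_all add: bij_is_inj)
  qed
  have permutes': "(inv f \<circ> p \<circ> f) permutes UNIV" if "p permutes UNIV" for p
    using bij_comp[OF f bij_comp[OF permutes_bij[OF that] bij_imp_bij_inv[OF f]]]
    by (intro bij_imp_permutes) (simp_all add: o_assoc)
  show ?thesis
    unfolding det_def
  proof (rule sum.reindex_bij_witness[of _ "\<lambda>p. inv f \<circ> p \<circ> f" "\<lambda>p. f \<circ> p \<circ> inv f"])
    fix p :: "'q \<Rightarrow> 'q" assume "p \<in> {p. p permutes UNIV}"
    then have p: "p permutes UNIV" by simp
    have "(\<Prod>i\<in>UNIV. A $ i $ (f \<circ> p \<circ> inv f) i) = (\<Prod>i\<in>UNIV. A $ f i $ f (p i))"
      using prod.reindex_bij_betw[OF f, of "\<lambda>i. A $ i $ (f \<circ> p \<circ> inv f) i"] by (simp add: inv)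
    then show "of_int (sign (f \<circ> p \<circ> inv f)) * (\<Prod>i\<in>UNIV. A $ i $ (f \<circ> p \<circ> inv f) i)
        = of_int (sign p) * (\<Prod>i\<in>UNIV. (\<chi> i j. A $ f i $ f j) $ i $ p i)"
      by (simp add: sign[OF p])
  qed (auto simp: fun_eq_iff inv permutes permutes')
qed

text \<open>For arbitrary \<open>h\<close>: each simple function below \<open>h\<close> pulls back
  to a measurable function below \<open>h\<close> composed with \<open>f\<close>.\<close>

lemma nn_integral_distr_le:
  assumes "f \<in> measurable M N"
  shows "(\<integral>\<^sup>+x. h x \<partial>distr M N f) \<le> (\<integral>\<^sup>+x. h (f x) \<partial>M)"
  unfolding nn_integral_def[of "distr M N f"]
proof (rule SUP_least, clarify)
  fix g assume g: "simple_function (distr M N f) g" "g \<le> h"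
  then have "g \<in> borel_measurable N"
    using borel_measurable_simple_function by fastforce
  then have "integral\<^sup>S (distr M N f) g = (\<integral>\<^sup>+x. g (f x) \<partial>M)"
    using g assms by (simp add: nn_integral_eq_simple_integral[symmetric] nn_integral_distr)
  also have "\<dots> \<le> (\<integral>\<^sup>+x. h (f x) \<partial>M)"
    using g by (intro nn_integral_mono) (simp add: le_fun_def)
  finally show "integral\<^sup>S (distr M N f) g \<le> (\<integral>\<^sup>+x. h (f x) \<partial>M)" .
qed

lemma nn_integral_distr_bij:
  assumes f: "f \<in> measurable M N" and g: "g \<in> measurable N M"
    and gf: "\<And>x. x \<in> space M \<Longrightarrow> g (f x) = x"
    and fg: "\<And>y. y \<in> space N \<Longrightarrow> f (g y) = y"
  shows "(\<integral>\<^sup>+x. h x \<partial>distr M N f) = (\<integral>\<^sup>+x. h (f x) \<partial>M)"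
proof (rule antisym[OF nn_integral_distr_le[OF f]])
  have M: "M = distr (distr M N f) M g"
    using f g gf by (simp add: distr_distr) (metis (no_types, lifting) distr_cong distr_id2 o_apply)
  have "(\<integral>\<^sup>+x. h (f x) \<partial>M) \<le> (\<integral>\<^sup>+x. h (f (g x)) \<partial>distr M N f)"
    using nn_integral_distr_le[of g "distr M N f" M "\<lambda>x. h (f x)"] g M by simp
  also have "\<dots> = (\<integral>\<^sup>+x. h x \<partial>distr M N f)"
    by (intro nn_integral_cong) (simp add: fg)
  finally show "(\<integral>\<^sup>+x. h (f x) \<partial>M) \<le> (\<integral>\<^sup>+x. h x \<partial>distr M N f)" .
qed

lemma prod_Basis_vec: "(\<Prod>b\<in>Basis. x \<bullet> b) = (\<Prod>k\<in>UNIV. x $ k)"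
  for x :: "real^'p"
proof -
  have "Basis = (\<lambda>k. axis k 1 :: real^'p) ` UNIV"
    by (auto simp: Basis_vec_def)
  moreover have "inj (\<lambda>k. axis k 1 :: real^'p)"
    by (auto simp: inj_def axis_eq_axis)
  ultimately show ?thesis
    by (subst \<open>Basis = _\<close>, subst prod.reindex) (auto simp: inner_axis)
qed

lemma emeasure_lborel_box_vec:
  fixes l u :: "real^'p"
  assumes "\<And>k. l $ k \<le> u $ k"
  shows "emeasure lborel (box l u) = (\<Prod>k\<in>UNIV. ennreal (u $ k - l $ k))"
proof -
  have "l \<bullet> b \<le> u \<bullet> b" if "b \<in> Basis" for b
    using that assms by (auto simp: Basis_vec_def inner_axis)
  then have "emeasure lborel (box l u) = ennreal (\<Prod>k\<in>UNIV. (u - l) $ k)"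
    by (simp only: emeasure_lborel_box prod_Basis_vec)
  then show ?thesis
    using assms by (simp add: prod_ennreal)
qed

lemma lborel_vec_eqI:
  fixes M :: "(real^'p) measure"
  assumes "\<And>l u. (\<And>k. l $ k \<le> u $ k) \<Longrightarrow> emeasure M (box l u) = (\<Prod>k\<in>UNIV. ennreal (u $ k - l $ k))"
    and "sets M = sets borel"
  shows "lborel = M"
proof (rule lborel_eqI)
  fix l u :: "real^'p" assume *: "\<And>b. b \<in> Basis \<Longrightarrow> l \<bullet> b \<le> u \<bullet> b"
  have "l $ k \<le> u $ k" for k
    using *[of "axis k 1"] by (simp add: inner_axis axis_in_Basis_iff)
  then show "emeasure M (box l u) = (\<Prod>b\<in>Basis. (u - l) \<bullet> b)"
    unfolding prod_Basis_vec by (simp add: assms(1) prod_ennreal)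
qed fact

lemma borel_measurable_linear: "linear f \<Longrightarrow> f \<in> borel_measurable borel"
  for f :: "'a::euclidean_space \<Rightarrow> 'b::euclidean_space"
  by (simp add: borel_measurable_continuous_onI linear_continuous_on linear_linear)

lemma borel_measurable_vec_reindex [measurable]:
  "(\<lambda>z :: real^'q. \<chi> k :: 'p::finite. z $ f k) \<in> borel_measurable borel"
  by (intro borel_measurable_linear linearI) (auto simp: vec_eq_iff)

lemma distr_lborel_reindex:
  fixes f :: "'p::finite \<Rightarrow> 'q::finite"
  assumes f: "bij f"
  shows "distr lborel borel (\<lambda>z :: real^'q. \<chi> k. z $ f k) = (lborel :: (real^'p) measure)"
proof (rule lborel_vec_eqI[symmetric])
  fix l u :: "real^'p" assume le: "\<And>k. l $ k \<le> u $ k"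
  have inv: "inv f (f x) = x" "f (inv f y) = y" for x y
    using f by (simp_all add: bij_is_inj bij_is_surj surj_f_inv_f)
  have "(\<lambda>z :: real^'q. \<chi> k. z $ f k) -` box l u = box (\<chi> m. l $ inv f m) (\<chi> m. u $ inv f m)"
  proof -
    have "(\<forall>k. P k) \<longleftrightarrow> (\<forall>m. P (inv f m))" for P
      by (metis inv)
    from this[of "\<lambda>k. l $ k < _ $ f k \<and> _ $ f k < u $ k"] show ?thesis
      by (auto simp: mem_box_cart inv)
  qed
  then have "emeasure (distr lborel borel (\<lambda>z :: real^'q. \<chi> k. z $ f k)) (box l u)
      = (\<Prod>m\<in>UNIV. ennreal (u $ inv f m - l $ inv f m))"
    by (subst emeasure_distr) (auto simp: emeasure_lborel_box_vec le)
  also have "\<dots> = (\<Prod>k\<in>UNIV. ennreal (u $ k - l $ k))"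
    using prod.reindex_bij_betw[OF bij_imp_bij_inv[OF f], of "\<lambda>k. ennreal (u $ k - l $ k)"] by simp
  finally show "emeasure (distr lborel borel (\<lambda>z :: real^'q. \<chi> k. z $ f k)) (box l u)
      = (\<Prod>k\<in>UNIV. ennreal (u $ k - l $ k))" .
qed simp

lemma nn_integral_lborel_reindex:
  fixes f :: "'p::finite \<Rightarrow> 'q::finite"
  assumes f: "bij f"
  shows "(\<integral>\<^sup>+x. h x \<partial>(lborel :: (real^'p) measure)) = (\<integral>\<^sup>+z. h (\<chi> k. z $ f k) \<partial>(lborel :: (real^'q) measure))"
proof -
  have inv: "inv f (f x) = x" "f (inv f y) = y" for x y
    using f by (simp_all add: bij_is_inj bij_is_surj surj_f_inv_f)
  have "(\<integral>\<^sup>+x. h x \<partial>(lborel :: (real^'p) measure)) = (\<integral>\<^sup>+x. h x \<partial>distr lborel borel (\<lambda>z :: real^'q. \<chi> k. z $ f k))"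
    by (simp add: distr_lborel_reindex[OF f])
  also have "\<dots> = (\<integral>\<^sup>+z. h (\<chi> k. z $ f k) \<partial>(lborel :: (real^'q) measure))"
    by (rule nn_integral_distr_bij[where g = "\<lambda>x. \<chi> m. x $ inv f m"]) (auto simp: inv)
  finally show ?thesis .
qed

text \<open>\<open>has_absolute_integral_change_of_variables\<close> concerns absolutely integrable
  functions with values in a vector type. Finiteness of the integral of \<open>f\<close> supplies
  integrability, \<open>real^1\<close> the target, and nonnegativity turns the result back into
  nonnegative integrals.\<close>

lemma nn_integral_change_of_variables_wellorder:
  fixes G :: "real^'m::{finite,wellorder} \<Rightarrow> real^'m::_" and f :: "real^'m::_ \<Rightarrow> real"
  assumes S: "S \<in> sets lebesgue"
    and der: "\<And>x. x \<in> S \<Longrightarrow> (G has_derivative G' x) (at x within S)"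
    and inj: "inj_on G S"
    and f: "f \<in> borel_measurable borel" "\<And>x. 0 \<le> f x" "(\<integral>\<^sup>+x. f x \<partial>lborel) < \<infinity>"
  shows "(\<integral>\<^sup>+y\<in>G ` S. ennreal (f y) \<partial>lborel)
      = (\<integral>\<^sup>+x\<in>S. ennreal (\<bar>det (matrix (G' x))\<bar> * f (G x)) \<partial>lborel)"
proof -
  have GS: "G ` S \<in> sets lebesgue"
    using der by (intro differentiable_image_in_sets_lebesgue[OF S])
      (auto simp: differentiable_on_def differentiable_def)
  have "integrable lborel f"
    using f by (intro integrableI_nonneg) auto
  then have "integrable lebesgue f"
    by (simp add: integrable_completion)
  then have "f absolutely_integrable_on (G ` S)"
    unfolding set_integrable_def using GS by (rule integrable_mult_indicator[rotated])
  then obtain b where b: "f absolutely_integrable_on (G ` S)" "integral (G ` S) f = b"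
    by blast
  have "(\<lambda>x. vec (f x) :: real^1) absolutely_integrable_on (G ` S)
      \<and> integral (G ` S) (\<lambda>x. vec (f x) :: real^1) = vec b"
    using b by (simp add: absolutely_integrable_on_1_iff integral_on_1_eq)
  then have cv: "(\<lambda>x. \<bar>det (matrix (G' x))\<bar> * f (G x)) absolutely_integrable_on S"
     "integral S (\<lambda>x. \<bar>det (matrix (G' x))\<bar> * f (G x)) = b"
    using has_absolute_integral_change_of_variables[OF S der inj, of "\<lambda>x. vec (f x) :: real^1" "vec b"]
    by (simp_all add: absolutely_integrable_on_1_iff integral_on_1_eq)
  from b have "(f has_integral b) (G ` S)"
    using set_lebesgue_integral_eq_integral(1) by blast
  moreover from cv have "((\<lambda>x. \<bar>det (matrix (G' x))\<bar> * f (G x)) has_integral b) S"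
    by (metis (no_types, lifting) set_lebesgue_integral_eq_integral(1) integrable_integral)
  ultimately show ?thesis
    using f(2) by (simp add: nn_integral_has_integral_lebesgue')
qed

text \<open>Conjugate \<open>G\<close> by the relabelling \<open>R\<close> of coordinates, with
  inverse \<open>R'\<close>; neither Lebesgue measure nor the Jacobian determinant changes.\<close>

lemma nn_integral_change_of_variables:
  fixes G :: "real^'p \<Rightarrow> real^'p" and f :: "real^'p \<Rightarrow> real"
  assumes S: "S \<in> sets borel"
    and der: "\<And>x. x \<in> S \<Longrightarrow> (G has_derivative G' x) (at x within S)"
    and inj: "inj_on G S"
    and f: "f \<in> borel_measurable borel" "\<And>x. 0 \<le> f x" "(\<integral>\<^sup>+x. f x \<partial>lborel) < \<infinity>"
  shows "(\<integral>\<^sup>+y\<in>G ` S. ennreal (f y) \<partial>lborel)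
      = (\<integral>\<^sup>+x\<in>S. ennreal (\<bar>det (matrix (G' x))\<bar> * f (G x)) \<partial>lborel)"
proof -
  define R :: "real^'p well_ordered \<Rightarrow> real^'p" where "R = (\<lambda>z. \<chi> k. z $ Abs_well_ordered k)"
  define R' :: "real^'p \<Rightarrow> real^'p well_ordered" where "R' = (\<lambda>x. \<chi> m. x $ Rep_well_ordered m)"
  have R [simp]: "R (R' x) = x" "R' (R z) = z" for x z
    by (simp_all add: R_def R'_def vec_eq_iff Abs_well_ordered_inverse Rep_well_ordered_inverse)
  have bij_Abs: "bij Abs_well_ordered"
    by (metis Abs_well_ordered_inverse Rep_well_ordered_inverse UNIV_I bijI')
  have nn_R: "(\<integral>\<^sup>+x. h x \<partial>lborel) = (\<integral>\<^sup>+z. h (R z) \<partial>lborel)" for h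
    unfolding R_def by (rule nn_integral_lborel_reindex[OF bij_Abs])
  have lin: "linear R" "linear R'"
    by (auto intro!: linearI simp: R_def R'_def vec_eq_iff)
  then have cont [intro]: "continuous_on A R" "continuous_on B R'" for A B
    by (simp_all add: linear_continuous_on linear_linear)
  have [measurable]: "R \<in> borel_measurable borel"
    by (intro borel_measurable_continuous_onI cont)
  define g where "g = R' \<circ> G \<circ> R"
  have image: "g ` (R -` S) = R -` (G ` S)"
  proof (intro set_eqI iffI)
    fix z assume "z \<in> R -` G ` S"
    then obtain x where "x \<in> S" "R z = G x" by auto
    then have "z = g (R' x)" "R' x \<in> R -` S"
      by (simp_all add: g_def flip: \<open>R z = G x\<close>)
    then show "z \<in> g ` (R -` S)" by blast
  qed (auto simp: g_def)
  have "(\<integral>\<^sup>+y\<in>G ` S. ennreal (f y) \<partial>lborel) = (\<integral>\<^sup>+z\<in>g ` (R -` S). ennreal (f (R z)) \<partial>lborel)"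
    unfolding nn_R image by (simp add: indicator_def)
  also have "\<dots> = (\<integral>\<^sup>+z\<in>R -` S. ennreal (\<bar>det (matrix (R' \<circ> G' (R z) \<circ> R))\<bar> * f (R (g z))) \<partial>lborel)"
  proof (rule nn_integral_change_of_variables_wellorder)
    have "R -` S \<in> sets borel"
      using measurable_sets[of R borel borel S] S by simp
    then show "R -` S \<in> sets lebesgue"
      by simp
    show "(g has_derivative R' \<circ> G' (R z) \<circ> R) (at z within R -` S)" if "z \<in> R -` S" for z
    proof -
      have "(R has_derivative R) (at z within R -` S)"
        using lin by (intro linear_imp_has_derivative)
      moreover have "(G has_derivative G' (R z)) (at (R z) within R ` (R -` S))"
        using der[of "R z"] that by (auto intro: has_derivative_subset)
      ultimately have "(G \<circ> R has_derivative G' (R z) \<circ> R) (at z within R -` S)"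
        by (rule diff_chain_within)
      from diff_chain_within[OF this linear_imp_has_derivative[OF lin(2)]]
      show ?thesis
        by (simp add: g_def o_assoc)
    qed
    show "inj_on g (R -` S)"
    proof (rule inj_onI)
      fix x y assume "x \<in> R -` S" "y \<in> R -` S" "g x = g y"
      then have "R x = R y"
        unfolding g_def using inj by (metis R(1) comp_apply inj_onD vimageD)
      then show "x = y"
        by (metis R(2))
    qed
    show "(\<lambda>z. f (R z)) \<in> borel_measurable borel"
      using f(1) by measurable
    show "(\<integral>\<^sup>+z. ennreal (f (R z)) \<partial>lborel) < \<infinity>"
      using f(3) by (simp add: nn_R)
  qed (rule f(2))
  also have "\<dots> = (\<integral>\<^sup>+x\<in>S. ennreal (\<bar>det (matrix (G' x))\<bar> * f (G x)) \<partial>lborel)"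
    unfolding nn_R[of "\<lambda>x. ennreal (\<bar>det (matrix (G' x))\<bar> * f (G x)) * indicator S x"]
  proof (intro nn_integral_cong)
    fix z
    have "matrix (R' \<circ> G' (R z) \<circ> R) = (\<chi> i j. matrix (G' (R z)) $ Rep_well_ordered i $ Rep_well_ordered j)"
    proof -
      have "R (axis j 1) = axis (Rep_well_ordered j) 1" for j
        by (auto simp: R_def axis_def vec_eq_iff Abs_well_ordered_inverse Rep_well_ordered_inverse)
      then show ?thesis
        by (simp add: matrix_def R'_def)
    qed
    then have "det (matrix (R' \<circ> G' (R z) \<circ> R)) = det (matrix (G' (R z)))"
      by (simp only: det_reindex[OF bij_Rep_well_ordered])
    then show "ennreal (\<bar>det (matrix (R' \<circ> G' (R z) \<circ> R))\<bar> * f (R (g z))) * indicator (R -` S) z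
        = ennreal (\<bar>det (matrix (G' (R z)))\<bar> * f (G (R z))) * indicator S (R z)"
      by (simp add: g_def indicator_def)
  qed
  finally show ?thesis .
qed

subsection \<open>Lebesgue measure on coordinate subspaces\<close>

lemma measurable_vec_lambda:
  fixes f :: "'a \<Rightarrow> 'p::finite \<Rightarrow> real"
  assumes "\<And>k. (\<lambda>x. f x k) \<in> borel_measurable M"
  shows "(\<lambda>x. \<chi> k. f x k) \<in> borel_measurable M"
  using assms by (subst borel_measurable_euclidean_space) (auto simp: Basis_vec_def inner_axis)

lemma measurable_vec_nth:
  assumes "f \<in> borel_measurable M"
  shows "(\<lambda>x. f x $ k :: real) \<in> borel_measurable M"
  using assms by (rule measurable_compose) (intro borel_measurable_continuous_onI continuous_intros)

lemma measurable_zero_extend: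
  "(\<lambda>x. \<chi> k. if k \<in> K then x k else 0) \<in> borel_measurable (Pi\<^sub>M K (\<lambda>_. lborel :: real measure))"
proof (intro measurable_vec_lambda)
  fix k
  show "(\<lambda>x. if k \<in> K then x k else 0) \<in> borel_measurable (Pi\<^sub>M K (\<lambda>_. lborel :: real measure))"
    using measurable_component_singleton[of k K "\<lambda>_. lborel :: real measure"]
    by (cases "k \<in> K") simp_all
qed

lemma sets_coord_lborel [simp, measurable_cong]: "sets (coord_lborel K) = sets borel"
  by (simp add: coord_lborel_def)

lemma space_coord_lborel [simp]: "space (coord_lborel K) = UNIV"
  by (simp add: coord_lborel_def)

text \<open>The measure is defined on the whole ambient space. Splitting and joining coordinates are
  mutually inverse only on the coordinate subspaces, and this fact restricts integrals to
  them.\<close>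

lemma AE_coord_lborel: "AE v in coord_lborel K. v \<in> coord_space K"
  unfolding coord_lborel_def
  by (subst AE_distr_iff[OF measurable_zero_extend]) (auto simp: coord_space_def)

lemma open_coord_box: "open {v :: real^'p. \<forall>k\<in>K. l k < v $ k \<and> v $ k < u k}"
proof -
  have "{v :: real^'p. \<forall>k\<in>K. l k < v $ k \<and> v $ k < u k} = (\<Inter>k\<in>K. {v. l k < v $ k} \<inter> {v. v $ k < u k})"
    by auto
  then show ?thesis
    by (auto intro!: open_INT open_Int open_Collect_less continuous_intros)
qed

lemma emeasure_coord_lborel_box:
  fixes K :: "'p::finite set"
  assumes "\<And>k. k \<in> K \<Longrightarrow> l k \<le> u k"
  shows "emeasure (coord_lborel K) {v. \<forall>k\<in>K. l k < v $ k \<and> v $ k < u k} = (\<Prod>k\<in>K. ennreal (u k - l k))"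
proof -
  interpret product_sigma_finite "\<lambda>_ :: 'p. lborel :: real measure" ..
  have "(\<lambda>x. \<chi> k. if k \<in> K then x k else 0) -` {v. \<forall>k\<in>K. l k < v $ k \<and> v $ k < u k}
        \<inter> space (Pi\<^sub>M K (\<lambda>_. lborel :: real measure)) = Pi\<^sub>E K (\<lambda>k. {l k<..<u k})"
    by (auto simp: space_PiM PiE_iff)
  then show ?thesis
    unfolding coord_lborel_def using assms
    by (subst emeasure_distr[OF measurable_zero_extend])
      (auto simp: open_coord_box emeasure_PiM intro!: prod.cong)
qed

lemma sigma_finite_coord_lborel: "sigma_finite_measure (coord_lborel K)"
proof
  let ?B = "\<lambda>n :: nat. {v :: real^'a. \<forall>k\<in>K. - real n < v $ k \<and> v $ k < real n}"
  have "v \<in> (\<Union>n. ?B n)" for v :: "real^'a"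
  proof -
    obtain n where "norm v < real n"
      using reals_Archimedean2 by blast
    then have "\<bar>v $ k\<bar> < real n" for k
      using component_le_norm_cart[of v k] by linarith
    then have "v \<in> ?B n"
      by (auto simp: abs_less_iff minus_less_iff)
    then show ?thesis by blast
  qed
  moreover have "emeasure (coord_lborel K) (?B n) \<noteq> \<infinity>" for n
    by (subst emeasure_coord_lborel_box) (auto simp: ennreal_power)
  ultimately show "\<exists>A. countable A \<and> A \<subseteq> sets (coord_lborel K) \<and> \<Union> A = space (coord_lborel K) \<and>
      (\<forall>a\<in>A. emeasure (coord_lborel K) a \<noteq> \<infinity>)"
    by (intro exI[of _ "range ?B"]) (auto simp: open_coord_box)
qed

text \<open>Packs a parameter \<open>\<theta> = (r, u)\<close> into one vector with a coordinate for
  each column of \<open>M\<close>, so that the parameter space and the range of \<open>H_map\<close>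
  have the same type, as a square Jacobian requires.\<close>

definition join_coords :: "('p \<Rightarrow> 'j + 'k) \<Rightarrow> real^'j \<Rightarrow> real^'k \<Rightarrow> real^'p" where
  "join_coords c r u = (\<chi> l. case c l of Inl j \<Rightarrow> r $ j | Inr k \<Rightarrow> u $ k)"

definition left_coords :: "('p \<Rightarrow> 'j + 'k) \<Rightarrow> 'j set \<Rightarrow> real^'p \<Rightarrow> real^'j" where
  "left_coords c A z = (\<chi> j. if j \<in> A then z $ inv c (Inl j) else 0)"

definition right_coords :: "('p \<Rightarrow> 'j + 'k) \<Rightarrow> 'k set \<Rightarrow> real^'p \<Rightarrow> real^'k" where
  "right_coords c F z = (\<chi> k. if k \<in> F then z $ inv c (Inr k) else 0)"

lemma linear_left_coords: "linear (left_coords c A)"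
  by (rule linearI) (auto simp: left_coords_def vec_eq_iff)

lemma linear_right_coords: "linear (right_coords c F)"
  by (rule linearI) (auto simp: right_coords_def vec_eq_iff)

lemma left_coords_in [simp]: "left_coords c A z \<in> coord_space A"
  by (simp add: left_coords_def coord_space_def)

lemma right_coords_in [simp]: "right_coords c F z \<in> coord_space F"
  by (simp add: right_coords_def coord_space_def)

lemma borel_measurable_left_coords [measurable]: "left_coords c A \<in> borel_measurable borel"
  by (intro borel_measurable_linear linear_left_coords)

lemma borel_measurable_right_coords [measurable]: "right_coords c F \<in> borel_measurable borel"
  by (intro borel_measurable_linear linear_right_coords)

context
  fixes c :: "'p::finite \<Rightarrow> 'j::finite + 'k::finite" and A :: "'j set" and F :: "'k set"
  assumes c: "bij_betw c UNIV (A <+> F)"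
begin

lemma inv_enum [simp]: "inv c (c l) = l" "j \<in> A \<Longrightarrow> c (inv c (Inl j)) = Inl j"
    "k \<in> F \<Longrightarrow> c (inv c (Inr k)) = Inr k"
  using c by (auto simp: bij_betw_def image_iff intro!: f_inv_into_f)

lemma enum_cases:
  obtains (left) j where "j \<in> A" "c l = Inl j" | (right) k where "k \<in> F" "c l = Inr k"
proof -
  have "c l \<in> A <+> F"
    using c by (auto simp: bij_betw_def)
  then show ?thesis
    by (auto intro: left right)
qed

lemma join_left_right [simp]: "join_coords c (left_coords c A z) (right_coords c F z) = z"
proof (subst vec_eq_iff, rule allI)
  fix l
  show "join_coords c (left_coords c A z) (right_coords c F z) $ l = z $ l"
    using inv_enum(1)[of l]
    by (cases l rule: enum_cases) (simp_all add: join_coords_def left_coords_def right_coords_def)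
qed

lemma left_join: "r \<in> coord_space A \<Longrightarrow> left_coords c A (join_coords c r u) = r"
  by (auto simp: join_coords_def left_coords_def vec_eq_iff coord_space_def)

lemma right_join: "u \<in> coord_space F \<Longrightarrow> right_coords c F (join_coords c r u) = u"
  by (auto simp: join_coords_def right_coords_def vec_eq_iff coord_space_def)

text \<open>Each unit vector moves a single parameter; the columns of the Jacobian are read off in
  this way.\<close>

lemma coords_axis_Inl:
  assumes "c l = Inl j"
  shows "left_coords c A (axis l 1) = axis j 1" "right_coords c F (axis l 1) = 0"
proof -
  have "inj c"
    using c by (simp add: bij_betw_def)
  then have ne: "c i \<noteq> Inl j" if "i \<noteq> l" for i
    using assms that by (metis injD)
  have *: "axis l 1 = join_coords c (axis j 1) 0"
  proof (subst vec_eq_iff, rule allI)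
    fix i
    show "axis l 1 $ i = join_coords c (axis j 1) 0 $ i"
      using assms ne[of i]
      by (cases "i = l"; cases "c i") (auto simp: join_coords_def axis_def)
  qed
  have "j \<in> A"
    using assms by (cases l rule: enum_cases) auto
  then show "left_coords c A (axis l 1) = axis j 1" "right_coords c F (axis l 1) = 0"
    unfolding * by (simp_all add: left_join right_join coord_space_def axis_def)
qed

lemma coords_axis_Inr:
  assumes "c l = Inr k"
  shows "left_coords c A (axis l 1) = 0" "right_coords c F (axis l 1) = axis k 1"
proof -
  have "inj c"
    using c by (simp add: bij_betw_def)
  then have ne: "c i \<noteq> Inr k" if "i \<noteq> l" for i
    using assms that by (metis injD)
  have *: "axis l 1 = join_coords c 0 (axis k 1)"
  proof (subst vec_eq_iff, rule allI)
    fix i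
    show "axis l 1 $ i = join_coords c 0 (axis k 1) $ i"
      using assms ne[of i]
      by (cases "i = l"; cases "c i") (auto simp: join_coords_def axis_def)
  qed
  have "k \<in> F"
    using assms by (cases l rule: enum_cases) auto
  then show "left_coords c A (axis l 1) = 0" "right_coords c F (axis l 1) = axis k 1"
    unfolding * by (simp_all add: left_join right_join coord_space_def axis_def)
qed

lemma borel_measurable_join_coords:
  "(\<lambda>(r, u). join_coords c r u) \<in> borel_measurable (coord_lborel A \<Otimes>\<^sub>M coord_lborel F)"
proof -
  have "(\<lambda>x. case c l of Inl j \<Rightarrow> fst x $ j | Inr k \<Rightarrow> snd x $ k)
      \<in> borel_measurable (coord_lborel A \<Otimes>\<^sub>M coord_lborel F)" for l
    by (cases "c l") (auto intro!: measurable_vec_nth measurable_compose[OF measurable_fst]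
        measurable_compose[OF measurable_snd] simp: measurable_ident_sets)
  then show ?thesis
    unfolding join_coords_def case_prod_beta by (rule measurable_vec_lambda)
qed

text \<open>The preimage of a box is a product of two boxes, and the product of side lengths over
  \<open>A <+> F\<close> is reindexed by \<open>c\<close>.\<close>

lemma distr_join_coords:
  "distr (coord_lborel A \<Otimes>\<^sub>M coord_lborel F) borel (\<lambda>(r, u). join_coords c r u) = lborel"
proof (rule lborel_vec_eqI[symmetric])
  interpret F: sigma_finite_measure "coord_lborel F"
    by (rule sigma_finite_coord_lborel)
  fix l u :: "real^'p" assume le: "\<And>k. l $ k \<le> u $ k"
  let ?l = "\<lambda>x. l $ inv c x" and ?u = "\<lambda>x. u $ inv c x"
  let ?A = "{r :: real^'j. \<forall>j\<in>A. ?l (Inl j) < r $ j \<and> r $ j < ?u (Inl j)}"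
  let ?F = "{v :: real^'k. \<forall>k\<in>F. ?l (Inr k) < v $ k \<and> v $ k < ?u (Inr k)}"
  have "join_coords c r v \<in> box l u \<longleftrightarrow> r \<in> ?A \<and> v \<in> ?F" for r v
  proof -
    have "(\<forall>i. P i) \<longleftrightarrow> (\<forall>j\<in>A. P (inv c (Inl j))) \<and> (\<forall>k\<in>F. P (inv c (Inr k)))" for P
      by (metis enum_cases inv_enum(1))
    from this[of "\<lambda>i. l $ i < join_coords c r v $ i \<and> join_coords c r v $ i < u $ i"]
    show ?thesis
      by (simp add: mem_box_cart join_coords_def)
  qed
  then have "(\<lambda>(r, v). join_coords c r v) -` box l u \<inter> space (coord_lborel A \<Otimes>\<^sub>M coord_lborel F) = ?A \<times> ?F"
    by (auto simp: space_pair_measure)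
  then have "emeasure (distr (coord_lborel A \<Otimes>\<^sub>M coord_lborel F) borel (\<lambda>(r, u). join_coords c r u)) (box l u)
      = emeasure (coord_lborel A) ?A * emeasure (coord_lborel F) ?F"
    by (subst emeasure_distr[OF borel_measurable_join_coords])
      (auto simp: F.emeasure_pair_measure_Times open_coord_box)
  also have "\<dots> = (\<Prod>j\<in>A. ennreal (?u (Inl j) - ?l (Inl j))) * (\<Prod>k\<in>F. ennreal (?u (Inr k) - ?l (Inr k)))"
    by (simp add: emeasure_coord_lborel_box le)
  also have "\<dots> = (\<Prod>x\<in>A <+> F. ennreal (?u x - ?l x))"
    by (simp add: prod.Plus)
  also have "\<dots> = (\<Prod>i\<in>UNIV. ennreal (u $ i - l $ i))"
    by (simp add: prod.reindex_bij_betw[OF c, symmetric])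
  finally show "emeasure (distr (coord_lborel A \<Otimes>\<^sub>M coord_lborel F) borel (\<lambda>(r, u). join_coords c r u)) (box l u)
      = (\<Prod>i\<in>UNIV. ennreal (u $ i - l $ i))" .
qed simp

lemma nn_integral_coord_lborel:
  assumes f: "f \<in> borel_measurable (borel \<Otimes>\<^sub>M borel)"
  shows "(\<integral>\<^sup>+r. \<integral>\<^sup>+u. f (r, u) \<partial>coord_lborel F \<partial>coord_lborel A)
       = (\<integral>\<^sup>+z. f (left_coords c A z, right_coords c F z) \<partial>lborel)"
proof -
  interpret F: sigma_finite_measure "coord_lborel F"
    by (rule sigma_finite_coord_lborel)
  let ?g = "\<lambda>z. f (left_coords c A z, right_coords c F z)"
  have g: "?g \<in> borel_measurable borel"
    using f by measurable
  have "(\<integral>\<^sup>+z. ?g z \<partial>lborel) = (\<integral>\<^sup>+x. ?g (case x of (r, u) \<Rightarrow> join_coords c r u) \<partial>(coord_lborel A \<Otimes>\<^sub>M coord_lborel F))"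
    using g by (subst distr_join_coords[symmetric], subst nn_integral_distr)
      (auto intro: borel_measurable_join_coords)
  also have "\<dots> = (\<integral>\<^sup>+r. \<integral>\<^sup>+u. ?g (join_coords c r u) \<partial>coord_lborel F \<partial>coord_lborel A)"
    using measurable_compose[OF borel_measurable_join_coords g] by (subst F.nn_integral_fst[symmetric]) auto
  also have "\<dots> = (\<integral>\<^sup>+r. \<integral>\<^sup>+u. f (r, u) \<partial>coord_lborel F \<partial>coord_lborel A)"
  proof (rule nn_integral_cong_AE, rule AE_mp[OF AE_coord_lborel], rule AE_I2, rule impI)
    fix r assume r: "r \<in> coord_space A"
    show "(\<integral>\<^sup>+u. ?g (join_coords c r u) \<partial>coord_lborel F) = (\<integral>\<^sup>+u. f (r, u) \<partial>coord_lborel F)"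
      by (rule nn_integral_cong_AE, rule AE_mp[OF AE_coord_lborel], rule AE_I2)
        (simp add: left_join r right_join)
  qed
  finally show ?thesis ..
qed

end

subsection \<open>Tangent spaces of the subgradient space\<close>

lemma has_derivative_vec_lambda:
  fixes f :: "'a::euclidean_space \<Rightarrow> 'p::finite \<Rightarrow> real"
  assumes "\<And>k. ((\<lambda>x. f x k) has_derivative (\<lambda>h. f' h k)) (at z within S)"
  shows "((\<lambda>x. \<chi> k. f x k) has_derivative (\<lambda>h. \<chi> k. f' h k)) (at z within S)"
  using assms
  by (subst has_derivative_componentwise_within) (auto simp: Basis_vec_def inner_axis)

lemma has_derivative_vec_nth:
  "(f has_derivative f') F \<Longrightarrow> ((\<lambda>x. f x $ k) has_derivative (\<lambda>h. f' h $ k)) F"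
  by (rule bounded_linear.has_derivative[OF bounded_linear_vec_nth])

text \<open>If \<open>s\<close> vanishes at \<open>z\<close> in coordinate \<open>k\<close>, it does
  so throughout \<open>B\<close>, so that component is constant within \<open>B\<close> and has
  derivative 0 whatever \<open>rho\<close> is. Accordingly \<open>d k\<close> is 0 there, even for
  \<open>rho = 1\<close>, where \<open>eta'\<close> has the value 1.\<close>

lemma has_derivative_estimate:
  fixes R :: "real^'p \<Rightarrow> real^'j" and sp :: "real^'p \<Rightarrow> real^'p" and grp :: "'p \<Rightarrow> 'j::finite"
  assumes R: "(R has_derivative R') (at z within B)"
    and sp: "(sp has_derivative sp') (at z within B)"
    and "z \<in> B"
    and zero: "\<And>k. grp k \<in> A \<Longrightarrow> sp z $ k \<noteq> 0 \<or> (\<forall>y\<in>B. sp y $ k = 0)"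
    and d: "\<And>k. d k = (if sp z $ k = 0 then 0 else eta' rho (sp z $ k))"
  shows "((\<lambda>y. estimate grp rho A (R y) (sp y)) has_derivative
     (\<lambda>h. \<chi> k. if grp k \<in> A then R z $ grp k * (sp' h $ k * d k) + R' h $ grp k * eta rho (sp z $ k) else 0))
     (at z within B)"
  unfolding estimate_def
proof (rule has_derivative_vec_lambda)
  fix k
  show "((\<lambda>y. if grp k \<in> A then R y $ grp k * eta rho (sp y $ k) else 0) has_derivative
     (\<lambda>h. if grp k \<in> A then R z $ grp k * (sp' h $ k * d k) + R' h $ grp k * eta rho (sp z $ k) else 0))
     (at z within B)"
  proof (cases "grp k \<in> A")
    case True
    have "((\<lambda>y. eta rho (sp y $ k)) has_derivative (\<lambda>h. sp' h $ k * d k)) (at z within B)"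
    proof (cases "sp z $ k = 0")
      case z0: True
      with zero[OF True] have "sp y $ k = 0" if "y \<in> B" for y
        using that by blast
      then have "((\<lambda>y. eta rho (sp y $ k)) has_derivative (\<lambda>h. 0)) (at z within B)"
        by (intro has_derivative_transform[OF \<open>z \<in> B\<close> _ has_derivative_const[of 0]]) simp
      with z0 show ?thesis
        by (simp add: d)
    next
      case False
      have "(eta rho has_derivative (*) (eta' rho (sp z $ k))) (at (sp z $ k))"
        using has_field_derivative_eta[OF False] by (simp add: has_field_derivative_def)
      from has_derivative_compose[OF has_derivative_vec_nth[OF sp, of k] this] False
      show ?thesis
        by (simp add: d mult.commute)
    qed
    from has_derivative_mult[OF has_derivative_vec_nth[OF R, of "grp k"] this] True
    show ?thesis by simp
  qed simp
qed

lemma subspace_coord_space: "subspace (coord_space K)"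
  by (auto simp: subspace_def coord_space_def)

lemma dim_coord_space: "dim (coord_space K :: (real^'p) set) = card K"
proof -
  have "inj (\<lambda>k. axis k 1 :: real^'p)"
    by (auto simp: inj_def axis_eq_axis)
  moreover have "coord_space K = {x :: real^'p. \<forall>i\<in>Basis. i \<notin> (\<lambda>k. axis k 1) ` K \<longrightarrow> x \<bullet> i = 0}"
    by (auto simp: coord_space_def Basis_vec_def inner_axis axis_eq_axis image_iff)
  ultimately show ?thesis
    using dim_substandard[of "(\<lambda>k. axis k 1 :: real^'p) ` K"]
    by (simp add: card_image inj_on_subset axis_in_Basis_iff image_subset_iff)
qed

text \<open>The columns of \<open>T\<close> span the tangent space of \<open>subgrad_space\<close>, the orthogonal complement of the
  vectors \<open>\<eta>(s\<^sub>(\<^sub>j\<^sub>))\<close>, \<open>j \<in> A\<close>. If \<open>s\<^sub>k = 0\<close>, it contains the \<open>k\<close>-th unit vector, which the projection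
  to the coordinates in \<open>F\<close> therefore must not annihilate.\<close>

lemma parameterized_zero_in_F:
  fixes grp :: "'p::finite \<Rightarrow> 'j::finite"
  assumes q: "1 < q" and param: "parameterized_by F \<Phi>0 sp T" and sub: "\<Phi>0 \<subseteq> subgrad_space grp q A"
    and card: "card A + card F = CARD('p)"
    and u: "u \<in> coord_proj F ` \<Phi>0" and zero: "sp u $ k = 0"
  shows "k \<in> F"
proof -
  let ?P = "coord_proj F ` \<Phi>0" and ?V = "(\<lambda>h. T u *v h) ` coord_space F"
  have sp: "sp v \<in> \<Phi>0" "coord_proj F (sp v) = v" if "v \<in> ?P" for v
    using that param by (auto simp: parameterized_by_def)
  have "u \<in> coord_space F"
    using u by (auto simp: coord_proj_def coord_space_def)
  obtain e where "0 < e" and e: "\<And>v. v \<in> coord_space F \<Longrightarrow> dist u v < e \<Longrightarrow> v \<in> ?P"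
    using param u unfolding parameterized_by_def openin_euclidean_subtopology_iff
    by (metis dist_commute)
  \<comment> \<open>Up to the factor \<open>q\<close>, this is the gradient at \<open>sp u\<close>
    of the sum of \<open>\<bar>s $ k\<bar> powr q\<close> over group \<open>j\<close>, which the
    constraint holds at 1 for active \<open>j\<close>.\<close>
  define n where "n = (\<lambda>j. eta_vec (q - 1) (block grp j (sp u)))"
  have tangent: "coord_proj F (T u *v h) = h" "j \<in> A \<Longrightarrow> n j \<bullet> (T u *v h) = 0"
    if h: "h \<in> coord_space F" for h j
  proof -
    \<comment> \<open>A curve through \<open>sp u\<close> with velocity \<open>T u *v h\<close>. It
      is known to stay in \<Phi>0 only for small \<open>t\<close>, which is enough to differentiate
      the chart identity and the norm constraints at 0.\<close>
    define \<gamma> where "\<gamma> = (\<lambda>t. sp (u + t *\<^sub>R h))"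
    have in_F: "u + t *\<^sub>R h \<in> coord_space F" for t
      using \<open>u \<in> coord_space F\<close> h subspace_coord_space[of F] by (simp add: subspace_add subspace_scale)
    have "(sp has_derivative (\<lambda>h. T u *v h)) (at (u + 0 *\<^sub>R h) within coord_space F)"
      using param u by (auto simp: parameterized_by_def)
    then have "(sp has_derivative (\<lambda>h. T u *v h)) (at (u + 0 *\<^sub>R h) within (\<lambda>t. u + t *\<^sub>R h) ` UNIV)"
      by (rule has_derivative_subset) (use in_F in auto)
    moreover have "((\<lambda>t. u + t *\<^sub>R h) has_derivative (\<lambda>t. t *\<^sub>R h)) (at 0)"
      by (auto intro!: derivative_eq_intros)
    ultimately have "(sp \<circ> (\<lambda>t. u + t *\<^sub>R h) has_derivative (\<lambda>h. T u *v h) \<circ> (\<lambda>t. t *\<^sub>R h)) (at 0)"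
      using diff_chain_within[of "\<lambda>t. u + t *\<^sub>R h" "\<lambda>t. t *\<^sub>R h" 0 UNIV sp "\<lambda>h. T u *v h"] by simp
    then have \<gamma>: "(\<gamma> has_derivative (\<lambda>t. t *\<^sub>R (T u *v h))) (at 0)"
      by (simp add: \<gamma>_def o_def matrix_vector_mult_scaleR)
    have \<gamma>_k: "((\<lambda>t. \<gamma> t $ k) has_field_derivative (T u *v h) $ k) (at 0)" for k
      using has_derivative_vec_nth[OF \<gamma>, of k] by (simp add: has_field_derivative_def mult_commute_abs)
    have "open {t :: real. dist u (u + t *\<^sub>R h) < e}"
      by (intro open_Collect_less continuous_intros)
    then have "\<forall>\<^sub>F t in nhds 0. dist u (u + t *\<^sub>R h) < e"
      using eventually_nhds_in_open[of "{t. dist u (u + t *\<^sub>R h) < e}" 0] \<open>0 < e\<close> by simp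
    then have near: "\<forall>\<^sub>F t in nhds 0. u + t *\<^sub>R h \<in> ?P"
      by (rule eventually_mono) (use e in_F in auto)
    have "(T u *v h) $ k = h $ k" if "k \<in> F" for k
    proof -
      have "\<forall>\<^sub>F t in nhds 0. u $ k + t * h $ k = \<gamma> t $ k"
        using near
      proof (rule eventually_mono)
        fix t assume "u + t *\<^sub>R h \<in> ?P"
        from sp(2)[OF this] have "coord_proj F (\<gamma> t) $ k = (u + t *\<^sub>R h) $ k"
          by (simp add: \<gamma>_def)
        then show "u $ k + t * h $ k = \<gamma> t $ k"
          using that by (simp add: coord_proj_def)
      qed
      moreover have "((\<lambda>t. u $ k + t * h $ k) has_field_derivative h $ k) (at 0)"
        by (auto intro!: derivative_eq_intros)
      ultimately have "((\<lambda>t. \<gamma> t $ k) has_field_derivative h $ k) (at 0)"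
        by (subst (asm) DERIV_cong_ev[OF refl _ refl])
      then show ?thesis
        using \<gamma>_k DERIV_unique by blast
    qed
    then show "coord_proj F (T u *v h) = h"
      using h by (auto simp: coord_proj_def coord_space_def vec_eq_iff)
    show "n j \<bullet> (T u *v h) = 0" if "j \<in> A"
    proof -
      let ?N = "\<lambda>s :: real^'p. \<Sum>k\<in>group_of grp j. \<bar>s $ k\<bar> powr q"
      have "((\<lambda>t. ?N (\<gamma> t)) has_field_derivative
          (\<Sum>k\<in>group_of grp j. q * eta (q - 1) (\<gamma> 0 $ k) * (T u *v h) $ k)) (at 0)"
        by (intro DERIV_sum DERIV_chain2[OF has_field_derivative_abs_powr[OF q] \<gamma>_k])
      moreover have "?N s = 1" if "s \<in> \<Phi>0" for s
      proof -
        have "lp_norm q (block grp j s) = 1"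
          using that sub \<open>j \<in> A\<close> by (auto simp: subgrad_space_def)
        then have "(\<Sum>k\<in>UNIV. \<bar>block grp j s $ k\<bar> powr q) = 1"
          using q by (simp add: lp_norm_eq_1_iff)
        moreover have "(\<Sum>k\<in>UNIV. \<bar>block grp j s $ k\<bar> powr q) = ?N s"
          by (intro sum.mono_neutral_cong_right) (auto simp: group_of_def)
        ultimately show ?thesis by simp
      qed
      then have "\<forall>\<^sub>F t in nhds 0. ?N (\<gamma> t) = 1"
        using near by (auto elim!: eventually_mono simp: \<gamma>_def intro: sp(1))
      ultimately have "((\<lambda>t :: real. 1 :: real) has_field_derivative
          (\<Sum>k\<in>group_of grp j. q * eta (q - 1) (\<gamma> 0 $ k) * (T u *v h) $ k)) (at 0)"
        by (subst (asm) DERIV_cong_ev[OF refl _ refl])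
      then have "(\<Sum>k\<in>group_of grp j. q * eta (q - 1) (\<gamma> 0 $ k) * (T u *v h) $ k) = 0"
        using DERIV_const DERIV_unique by blast
      moreover have "q * (n j \<bullet> (T u *v h)) = (\<Sum>k\<in>group_of grp j. q * eta (q - 1) (\<gamma> 0 $ k) * (T u *v h) $ k)"
        unfolding inner_vec_def sum_distrib_left
        by (intro sum.mono_neutral_cong_right) (auto simp: n_def eta_vec_def group_of_def \<gamma>_def)
      ultimately show ?thesis
        using q by simp
    qed
  qed
  have subspace_V: "subspace ?V"
    by (intro linear_subspace_image subspace_coord_space) simp
  have "inj_on (\<lambda>h. T u *v h) (coord_space F)"
    by (metis inj_onI tangent(1))
  then have dim_V: "dim ?V = card F"
    by (simp add: dim_image_eq span_eq_iff[THEN iffD2, OF subspace_coord_space] dim_coord_space)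
  have n_nonzero: "n j \<noteq> 0" if "j \<in> A" for j
  proof
    assume "n j = 0"
    then have "block grp j (sp u) = 0"
      by (simp add: n_def eta_vec_def vec_eq_iff)
    moreover have "lp_norm q (block grp j (sp u)) = 1"
      using that sub sp(1)[OF u] by (auto simp: subgrad_space_def)
    ultimately show False by simp
  qed
  have n_orth: "n i \<bullet> n j = 0" if "i \<noteq> j" for i j
    using that by (auto simp: n_def inner_vec_def eta_vec_def intro!: sum.neutral)
  have "inj_on n A"
    by (rule inj_onI) (metis n_nonzero n_orth inner_eq_zero_iff)
  moreover have "independent (n ` A)"
    by (intro pairwise_orthogonal_independent)
      (auto simp: pairwise_def orthogonal_def n_nonzero intro: n_orth)
  ultimately have dim_N: "dim (n ` A) = card A"
    by (simp add: dim_eq_card_independent card_image)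
  let ?K = "{y. \<forall>x\<in>span (n ` A). orthogonal x y}"
  have K_iff: "y \<in> ?K \<longleftrightarrow> (\<forall>j\<in>A. n j \<bullet> y = 0)" for y
  proof
    assume 0: "\<forall>j\<in>A. n j \<bullet> y = 0"
    have "orthogonal y x" if "x \<in> span (n ` A)" for x
      by (rule orthogonal_to_span[OF that]) (use 0 in \<open>auto simp: orthogonal_def inner_commute\<close>)
    then show "y \<in> ?K"
      by (simp add: orthogonal_commute)
  next
    assume y: "y \<in> ?K"
    have "orthogonal (n j) y" if "j \<in> A" for j
      using y span_base[OF imageI[OF that, of n]] by simp
    then show "\<forall>j\<in>A. n j \<bullet> y = 0"
      by (simp add: orthogonal_def)
  qed
  \<comment> \<open>Dimension count: \<open>T u\<close> is injective on the coordinate subspace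
    since the projection inverts it, and the \<open>n j\<close> are nonzero and pairwise orthogonal.
    Both spaces have dimension \<open>card F\<close>, so the inclusion is an equality.\<close>
  have "dim ?K + card A = CARD('p)"
    using dim_subspace_orthogonal_to_vectors[of "span (n ` A)" UNIV] by (simp add: dim_N)
  then have "dim ?K = dim ?V"
    using card dim_V by simp
  moreover have "?V \<subseteq> ?K"
    unfolding subset_iff K_iff using tangent(2) by blast
  moreover have "subspace ?K"
    by (auto simp: subspace_def orthogonal_def inner_add)
  ultimately have "?V = ?K"
    using subspace_V by (intro subspace_dim_equal) auto
  moreover have "axis k 1 \<in> ?K"
    unfolding K_iff using zero by (simp add: inner_axis n_def eta_vec_def)
  ultimately obtain h where h: "h \<in> coord_space F" "axis k 1 = T u *v h"
    by blast
  show "k \<in> F"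
  proof (rule ccontr)
    assume "k \<notin> F"
    then have "coord_proj F (axis k 1 :: real^'p) = 0"
      by (auto simp: coord_proj_def axis_def vec_eq_iff)
    then have "h = 0"
      using tangent(1)[OF h(1)] h(2) by simp
    then show False
      using h(2) by simp
  qed
qed

subsection \<open>The law of the augmented estimator\<close>

text \<open>The inequality makes \<open>f\<close> constant on the fibres of \<open>U\<close>, so it
  factors through a Lipschitz function \<open>\<phi>\<close> on the range of \<open>U\<close>. The
  range may fail to be measurable; hence \<open>\<phi>\<close> is extended continuously to its
  closure.\<close>

lemma borel_measurable_of_dist_le:
  fixes f :: "'a \<Rightarrow> 'b::euclidean_space" and U :: "'a \<Rightarrow> 'c::euclidean_space"
  assumes U: "U \<in> borel_measurable M" and c: "0 < c"
    and le: "\<And>x y. x \<in> space M \<Longrightarrow> y \<in> space M \<Longrightarrow> c * dist (f x) (f y) \<le> dist (U x) (U y)"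
  shows "f \<in> borel_measurable M"
proof -
  define \<phi> where "\<phi> = (\<lambda>v. f (SOME x. x \<in> space M \<and> U x = v))"
  have \<phi>: "\<phi> (U x) = f x" if x: "x \<in> space M" for x
  proof -
    define y where "y = (SOME y. y \<in> space M \<and> U y = U x)"
    have "y \<in> space M \<and> U y = U x"
      unfolding y_def by (rule someI[of _ x]) (use x in simp)
    then have "c * dist (f y) (f x) \<le> 0"
      using le[of y x] x by simp
    then show ?thesis
      using c by (simp add: \<phi>_def y_def mult_le_0_iff)
  qed
  have "(1 / c)-lipschitz_on (U ` space M) \<phi>"
    using c le by (intro lipschitz_onI) (auto simp: \<phi> field_simps)
  then have "uniformly_continuous_on (U ` space M) \<phi>"
    by (rule lipschitz_on_uniformly_continuous)
  then obtain h where h: "uniformly_continuous_on (closure (U ` space M)) h"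
      and eq: "\<And>v. v \<in> U ` space M \<Longrightarrow> \<phi> v = h v"
    using uniformly_continuous_on_extension_on_closure by metis
  then have "(\<lambda>v. indicator (closure (U ` space M)) v *\<^sub>R h v) \<in> borel_measurable borel"
    by (intro borel_measurable_continuous_on_indicator) (auto intro: uniformly_continuous_imp_continuous)
  from measurable_compose[OF U this]
  have "(\<lambda>x. indicator (closure (U ` space M)) (U x) *\<^sub>R h (U x)) \<in> borel_measurable M" .
  moreover have "indicator (closure (U ` space M)) (U x) *\<^sub>R h (U x) = f x" if "x \<in> space M" for x
    using that closure_subset[of "U ` space M"] \<phi>[OF that] eq[of "U x"]
    by (auto simp: indicator_def)
  ultimately show ?thesis
    by (simp cong: measurable_cong)
qed

text \<open>\<open>L\<close> differs from a Borel set by a subset of a null set, whose preimage is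
  null because \<open>U\<close> has a density. The measure \<open>M\<close> may be incomplete, so
  measurability of the event is a separate premise.\<close>

lemma emeasure_distributed_lebesgue:
  fixes U :: "'a \<Rightarrow> 'b::euclidean_space"
  assumes D: "distributed M lborel U f" and L: "L \<in> sets lebesgue"
    and E: "{x \<in> space M. U x \<in> L} \<in> sets M"
  shows "emeasure M {x \<in> space M. U x \<in> L} = (\<integral>\<^sup>+v\<in>L. f v \<partial>lborel)"
proof -
  obtain B N N' where L_eq: "L = B \<union> N" and "N \<subseteq> N'" and N': "N' \<in> null_sets lborel" and B: "B \<in> sets lborel"
    using L by (rule sets_completionE)
  have "emeasure M (U -` N' \<inter> space M) = (\<integral>\<^sup>+v. f v * indicator N' v \<partial>lborel)"
    using D N' by (intro distributed_emeasure) auto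
  also have "\<dots> = 0"
    using N' by (rule nn_integral_null_set)
  finally have null: "U -` N' \<inter> space M \<in> null_sets M"
    using D N' by (auto simp: distributed_def null_sets_def intro: measurable_sets)
  have "AE x in M. x \<in> {x \<in> space M. U x \<in> L} \<longleftrightarrow> x \<in> U -` B \<inter> space M"
    by (rule AE_mp[OF AE_not_in[OF null]]) (use L_eq \<open>N \<subseteq> N'\<close> in auto)
  then have "emeasure M {x \<in> space M. U x \<in> L} = emeasure M (U -` B \<inter> space M)"
    using D B E by (intro emeasure_eq_AE) (auto simp: distributed_def intro: measurable_sets)
  also have "\<dots> = (\<integral>\<^sup>+v\<in>B. f v \<partial>lborel)"
    using D B by (rule distributed_emeasure)
  also have "\<dots> = (\<integral>\<^sup>+v\<in>L. f v \<partial>lborel)"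
    by (rule nn_integral_cong_AE, rule AE_mp[OF AE_not_in[OF N']])
      (use L_eq \<open>N \<subseteq> N'\<close> in \<open>auto simp: indicator_def\<close>)
  finally show ?thesis .
qed

section \<open>Measurability of determinants, estimates and the subgradient space\<close>

lemma borel_measurable_det:
  fixes M :: "'a \<Rightarrow> real^'p^'p"
  assumes "\<And>i j. (\<lambda>x. M x $ i $ j) \<in> borel_measurable N"
  shows "(\<lambda>x. det (M x)) \<in> borel_measurable N"
  unfolding det_def using assms
  by (intro borel_measurable_sum borel_measurable_times borel_measurable_prod) auto

lemma measurable_matrix_vector_mult:
  fixes M :: "real^'p^'n"
  assumes "f \<in> borel_measurable N"
  shows "(\<lambda>x. M *v f x) \<in> borel_measurable N"
  using assms by (rule measurable_compose) (intro borel_measurable_linear, simp)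

lemma measurable_estimate:
  fixes grp :: "'p::finite \<Rightarrow> 'j::finite"
  assumes "R \<in> borel_measurable N" "s \<in> borel_measurable N"
  shows "(\<lambda>x. estimate grp rho A (R x) (s x)) \<in> borel_measurable N"
proof -
  have "(\<lambda>x. if grp k \<in> A then R x $ grp k * eta rho (s x $ k) else 0) \<in> borel_measurable N" for k
    using measurable_vec_nth[OF assms(1), of "grp k"]
      measurable_compose[OF measurable_vec_nth[OF assms(2), of k] borel_measurable_eta]
    by (cases "grp k \<in> A") simp_all
  then show ?thesis
    unfolding estimate_def by (rule measurable_vec_lambda)
qed

lemma r_circ_gram_D_mat:
  fixes X :: "real^'p^'n"
  shows "(r_circ_gram grp r X ** D_mat grp rho A s) $ i $ k =
    r $ grp k * gram X $ i $ k * (if grp k \<in> A then eta' rho (s $ k) else 0)"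
proof -
  have "(r_circ_gram grp r X ** D_mat grp rho A s) $ i $ k =
      (\<Sum>l\<in>UNIV. r $ grp l * gram X $ i $ l * (if l = k \<and> grp l \<in> A then eta' rho (s $ l) else 0))"
    by (simp add: matrix_matrix_mult_def r_circ_gram_def D_mat_def)
  also have "\<dots> = (\<Sum>l\<in>UNIV. if l = k
      then r $ grp k * gram X $ i $ k * (if grp k \<in> A then eta' rho (s $ k) else 0) else 0)"
    by (rule sum.cong) auto
  finally show ?thesis by simp
qed

lemma subgrad_space_borel: "subgrad_space grp q A \<in> sets borel"
  for grp :: "'p::finite \<Rightarrow> 'j::finite"
proof -
  have "subgrad_space grp q A = (\<Inter>j. {s. (j \<in> A \<longrightarrow> lp_norm q (block grp j s) = 1)
      \<and> (j \<notin> A \<longrightarrow> lp_norm q (block grp j s) \<le> 1)})"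
    by (auto simp: subgrad_space_def)
  also have "\<dots> \<in> sets borel"
    by measurable
  finally show ?thesis .
qed

section \<open>The deterministic map from parameters to noise values, its strata and its
  Jacobian\<close>

locale parameterized_lasso = conjugate_exponents p q for p q :: real +
  fixes X :: "real^'p^'n" and grp :: "'p::finite \<Rightarrow> 'j::finite" and w :: "real^'j" and lam :: real
    and \<beta>0 :: "real^'p" and A :: "'j set" and F :: "'p set" and \<Gamma> :: "(real^'j) set"
    and \<Phi>0 \<Delta> :: "(real^'p) set" and sp :: "real^'p \<Rightarrow> real^'p" and T :: "real^'p \<Rightarrow> real^'p^'p"
    and c :: "'p \<Rightarrow> 'j + 'p"
  assumes weights: "\<forall>j. w $ j > 0" and lam: "lam > 0" and rank: "rank X = CARD('p)"
    and Gamma: "\<Gamma> \<in> sets borel" "\<Gamma> \<subseteq> {r \<in> coord_space A. \<forall>j\<in>A. r $ j > 0}"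
    and Phi0: "openin (top_of_set (subgrad_space grp q A)) \<Phi>0"
    and param: "parameterized_by F \<Phi>0 sp T"
    and Delta: "\<Delta> \<in> sets borel" "\<Delta> \<subseteq> coord_proj F ` \<Phi>0"
    and columns: "bij_betw c UNIV (A <+> F)"
begin

abbreviation "rho \<equiv> q / p"
abbreviation "L \<equiv> left_coords c A"
abbreviation "R \<equiv> right_coords c F"

definition G :: "real^'p \<Rightarrow> real^'p" where
  "G z = H_map grp rho w X A (L z) (sp (R z)) \<beta>0 lam"

definition Dom :: "(real^'p) set" where
  "Dom = {z. L z \<in> \<Gamma> \<and> R z \<in> \<Delta>}"

text \<open>On the stratum of \<open>K\<close>, the coordinates in \<open>K\<close> are those active coordinates at which \<open>\<eta>\<close> may
  fail to be differentiable; there \<open>\<eta>(s\<^sub>k)\<close> is constant.\<close>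

definition stratum :: "'p set \<Rightarrow> (real^'p) set" where
  "stratum K = {z \<in> Dom. {k. grp k \<in> A \<and> sp (R z) $ k = 0} = K}"

text \<open>The derivative of \<open>G\<close> within a stratum. The factor 0 at a zero of
  \<open>sp\<close> is the derivative of a constant component; on \<open>stratum {}\<close> no
  active coordinate meets this case.\<close>

definition G' :: "real^'p \<Rightarrow> real^'p \<Rightarrow> real^'p" where
  "G' z h = gram X *v (\<chi> k. if grp k \<in> A
       then L z $ grp k * ((T (R z) *v R h) $ k * (if sp (R z) $ k = 0 then 0 else eta' rho (sp (R z) $ k)))
         + L h $ grp k * eta rho (sp (R z) $ k)
       else 0) + lam *\<^sub>R (weight_mat grp w *v (T (R z) *v R h))"

lemma Delta_coord_space: "u \<in> \<Delta> \<Longrightarrow> u \<in> coord_space F"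
  using Delta(2) by (auto simp: coord_proj_def coord_space_def)

lemma sp_Delta: "u \<in> \<Delta> \<Longrightarrow> sp u \<in> \<Phi>0" "u \<in> \<Delta> \<Longrightarrow> coord_proj F (sp u) = u"
  using Delta(2) param by (auto simp: parameterized_by_def)

lemma Phi0_sub: "\<Phi>0 \<subseteq> subgrad_space grp q A"
  using Phi0 openin_imp_subset by blast

lemma sp_subgrad_space: "u \<in> \<Delta> \<Longrightarrow> sp u \<in> subgrad_space grp q A"
  using Phi0_sub sp_Delta(1) by blast

lemma Gamma_coord: "r \<in> \<Gamma> \<Longrightarrow> r \<in> coord_space A" "r \<in> \<Gamma> \<Longrightarrow> \<forall>j\<in>A. 0 < r $ j"
  using Gamma(2) by auto

lemma card_A_F: "card A + card F = CARD('p)"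
  using bij_betw_same_card[OF columns] by (simp add: card_Plus)

lemma zero_in_F:
  assumes "u \<in> \<Delta>" "sp u $ k = 0"
  shows "k \<in> F" "u $ k = 0"
proof -
  show "k \<in> F"
    using parameterized_zero_in_F[OF q_gt_1 param Phi0_sub card_A_F _ assms(2)] assms(1) Delta(2) by auto
  then have "coord_proj F (sp u) $ k = 0"
    using assms(2) by (simp add: coord_proj_def)
  then show "u $ k = 0"
    using sp_Delta(2)[OF assms(1)] by simp
qed

lemma image_G_Dom: "G ` Dom = {H_map grp rho w X A r (sp u) \<beta>0 lam | r u. r \<in> \<Gamma> \<and> u \<in> \<Delta>}"
proof (intro set_eqI iffI)
  fix v assume "v \<in> {H_map grp rho w X A r (sp u) \<beta>0 lam | r u. r \<in> \<Gamma> \<and> u \<in> \<Delta>}"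
  then obtain r u where *: "r \<in> \<Gamma>" "u \<in> \<Delta>" "v = H_map grp rho w X A r (sp u) \<beta>0 lam"
    by blast
  then have "L (join_coords c r u) = r" "R (join_coords c r u) = u"
    by (simp_all add: left_join[OF columns] right_join[OF columns] Gamma_coord Delta_coord_space)
  then have "join_coords c r u \<in> Dom" "v = G (join_coords c r u)"
    using * by (simp_all add: Dom_def G_def)
  then show "v \<in> G ` Dom" by blast
qed (auto simp: G_def Dom_def)

lemma estimate_sp:
  assumes "r \<in> \<Gamma>" "u \<in> \<Delta>"
  shows "dual_pair grp p q (estimate grp rho A r (sp u)) (sp u)"
    "active_set grp (estimate grp rho A r (sp u)) = A"
    "coord_proj A (block_norms grp p (estimate grp rho A r (sp u))) = r"
  using estimate_dual_pair[OF sp_subgrad_space[OF assms(2)] Gamma_coord[OF assms(1)]] by blast+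

text \<open>Equal values are two dual pairs solving the same equation. Uniqueness identifies the
  pairs, and \<open>r\<close> and \<open>u\<close> are recovered as block norms and as the
  projection of \<open>s\<close>.\<close>

lemma inj_on_G: "inj_on G Dom"
proof (rule inj_onI)
  fix x y assume x: "x \<in> Dom" and y: "y \<in> Dom" and "G x = G y"
  then have D: "L x \<in> \<Gamma>" "R x \<in> \<Delta>" "L y \<in> \<Gamma>" "R y \<in> \<Delta>"
    by (simp_all add: Dom_def)
  have "gram X *v estimate grp rho A (L x) (sp (R x)) + lam *\<^sub>R (weight_mat grp w *v sp (R x))
      = gram X *v estimate grp rho A (L y) (sp (R y)) + lam *\<^sub>R (weight_mat grp w *v sp (R y))"
    using \<open>G x = G y\<close> by (simp add: G_def H_map_eq)
  from dual_pair_unique[OF rank weights lam estimate_sp(1)[OF D(1,2)] estimate_sp(1)[OF D(3,4)] this]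
  have "L x = L y" "R x = R y"
    using estimate_sp(3)[OF D(1,2)] estimate_sp(3)[OF D(3,4)] sp_Delta(2)[OF D(2)] sp_Delta(2)[OF D(4)]
    by metis+
  then show "x = y"
    using join_left_right[OF columns] by metis
qed

lemma continuous_on_sp: "continuous_on \<Delta> sp"
proof -
  have "(sp has_derivative (\<lambda>h. T u *v h)) (at u within \<Delta>)" if "u \<in> \<Delta>" for u
  proof (rule has_derivative_subset)
    show "(sp has_derivative (\<lambda>h. T u *v h)) (at u within coord_space F)"
      using param that Delta(2) by (auto simp: parameterized_by_def)
  qed (auto intro: Delta_coord_space)
  then show ?thesis
    by (meson continuous_on_eq_continuous_within has_derivative_continuous)
qed

text \<open>Nothing is known about \<open>sp\<close> away from the chart, so it is cut off to 0
  outside \<Delta>; the indicator in the integrand hides the change.\<close>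

lemma measurable_sp: "(\<lambda>u. if u \<in> \<Delta> then sp u else 0) \<in> borel_measurable borel"
  using borel_measurable_continuous_on_indicator[OF Delta(1) continuous_on_sp]
  by (simp add: indicator_scaleR_eq_if)

lemma measurable_column_T:
  assumes "k \<in> F"
  shows "(\<lambda>u. if u \<in> \<Delta> then column k (T u) else 0) \<in> borel_measurable borel"
proof -
  have "continuous_on \<Delta> (\<lambda>u. column k (T u))"
    using param assms Delta(2) by (auto simp: parameterized_by_def intro: continuous_on_subset)
  from borel_measurable_continuous_on_indicator[OF Delta(1) this]
  have "(\<lambda>u. indicator \<Delta> u *\<^sub>R column k (T u)) \<in> borel_measurable borel" .
  also have "(\<lambda>u. indicator \<Delta> u *\<^sub>R column k (T u)) = (\<lambda>u. if u \<in> \<Delta> then column k (T u) else 0)"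
    by (auto simp: fun_eq_iff indicator_def)
  finally show ?thesis .
qed

lemma Dom_borel: "Dom \<in> sets borel"
proof -
  have "L -` \<Gamma> \<in> sets borel" "R -` \<Delta> \<in> sets borel"
    using measurable_sets_borel[OF borel_measurable_left_coords Gamma(1)]
      measurable_sets_borel[OF borel_measurable_right_coords Delta(1)] by auto
  moreover have "Dom = L -` \<Gamma> \<inter> R -` \<Delta>"
    by (auto simp: Dom_def)
  ultimately show ?thesis by simp
qed

lemma stratum_borel: "stratum K \<in> sets borel"
proof -
  let ?s = "\<lambda>z. if R z \<in> \<Delta> then sp (R z) else 0"
  have s: "?s \<in> borel_measurable borel"
    using measurable_compose[OF borel_measurable_right_coords measurable_sp] .
  have "stratum K = Dom \<inter> (\<Inter>k. {z \<in> space borel. (grp k \<in> A \<and> ?s z $ k = 0) = (k \<in> K)})"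
    by (auto simp: stratum_def Dom_def)
  also have "{z \<in> space borel. (grp k \<in> A \<and> ?s z $ k = 0) = (k \<in> K)} \<in> sets borel" for k
    using measurable_vec_nth[OF s, of k] by measurable
  then have "Dom \<inter> (\<Inter>k. {z \<in> space borel. (grp k \<in> A \<and> ?s z $ k = 0) = (k \<in> K)}) \<in> sets borel"
    using Dom_borel by blast
  finally show ?thesis .
qed

lemma G_has_derivative:
  assumes z: "z \<in> stratum K"
  shows "(G has_derivative G' z) (at z within stratum K)"
proof -
  have u: "R z \<in> \<Delta>"
    using z by (simp add: stratum_def Dom_def)
  have "(sp has_derivative (\<lambda>h. T (R z) *v h)) (at (R z) within coord_space F)"
    using param u Delta(2) by (auto simp: parameterized_by_def)
  then have "(sp has_derivative (\<lambda>h. T (R z) *v h)) (at (R z) within R ` stratum K)"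
    by (rule has_derivative_subset) auto
  from diff_chain_within[OF linear_imp_has_derivative[OF linear_right_coords] this]
  have sp: "((\<lambda>y. sp (R y)) has_derivative (\<lambda>h. T (R z) *v R h)) (at z within stratum K)"
    by (simp add: o_def)
  have "((\<lambda>y. estimate grp rho A (L y) (sp (R y))) has_derivative
     (\<lambda>h. \<chi> k. if grp k \<in> A then L z $ grp k * ((T (R z) *v R h) $ k *
        (if sp (R z) $ k = 0 then 0 else eta' rho (sp (R z) $ k))) + L h $ grp k * eta rho (sp (R z) $ k) else 0))
     (at z within stratum K)"
    by (rule has_derivative_estimate[OF linear_imp_has_derivative[OF linear_left_coords] sp z])
      (use z in \<open>auto simp: stratum_def\<close>)
  from bounded_linear.has_derivative[OF matrix_vector_mul_bounded_linear[of "gram X"] this]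
    bounded_linear.has_derivative[OF bounded_linear_scaleR_right[of lam]
      bounded_linear.has_derivative[OF matrix_vector_mul_bounded_linear[of "weight_mat grp w"] sp]]
  have "((\<lambda>y. gram X *v estimate grp rho A (L y) (sp (R y)) + lam *\<^sub>R (weight_mat grp w *v sp (R y)))
      has_derivative G' z) (at z within stratum K)"
    unfolding G'_def[abs_def] by (rule has_derivative_add)
  from has_derivative_diff[OF this has_derivative_const[of "gram X *v \<beta>0"]]
  show ?thesis
    by (simp add: G_def[abs_def] H_map_eq)
qed

text \<open>Column by column: a column labelled by \<open>A\<close> is the derivative in one
  \<open>r $ j\<close>, a column labelled by \<open>F\<close> the derivative in one
  \<open>u $ m\<close>, where the chain rule brings in column \<open>m\<close> of
  \<open>T\<close>.\<close>

lemma matrix_G':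
  assumes z: "z \<in> stratum {}"
  shows "matrix (G' z) = M_mat c grp rho w X A (L z) (sp (R z)) (T (R z)) lam"
proof -
  let ?s = "sp (R z)" and ?T = "T (R z)" and ?r = "L z"
  have nonzero: "?s $ k \<noteq> 0" if "grp k \<in> A" for k
    using z that by (auto simp: stratum_def)
  have "G' z (axis l 1) $ i = M_mat c grp rho w X A ?r ?s ?T lam $ i $ l" for i l
  proof (cases l rule: enum_cases[OF columns, case_names left right])
    case (left j)
    from coords_axis_Inl[OF columns left(2)]
    have "G' z (axis l 1) = gram X *v (\<chi> k. if grp k \<in> A then axis j 1 $ grp k * eta rho (?s $ k) else 0)"
      by (simp add: G'_def cong: if_cong)
    also have "(\<chi> k. if grp k \<in> A then axis j 1 $ grp k * eta rho (?s $ k) else 0) = eta_vec rho (block grp j ?s)"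
      using left by (auto simp: vec_eq_iff eta_vec_def axis_def)
    finally show ?thesis
      using left by (simp add: M_mat_def)
  next
    case (right m)
    from coords_axis_Inr[OF columns right(2)]
    have "G' z (axis l 1) $ i =
        (\<Sum>k\<in>UNIV. gram X $ i $ k * (if grp k \<in> A then ?r $ grp k * (?T $ k $ m * eta' rho (?s $ k)) else 0))
        + lam * (w $ grp i * ?T $ i $ m)"
      by (auto simp: G'_def matrix_vector_mult_basis column_def matrix_vector_mult_def[of "gram X"] nonzero
          intro!: sum.cong)
    also have "\<dots> = (\<Sum>k\<in>UNIV. (?r $ grp k * gram X $ i $ k * (if grp k \<in> A then eta' rho (?s $ k) else 0)
        + lam * (if i = k then w $ grp i else 0)) * ?T $ k $ m)"
    proof -
      have *: "lam * (w $ grp i * ?T $ i $ m) = (\<Sum>k\<in>UNIV. if i = k then lam * (w $ grp i * ?T $ i $ m) else 0)"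
        by simp
      show ?thesis
        by (subst *, subst sum.distrib[symmetric]) (auto simp: algebra_simps intro!: sum.cong)
    qed
    also have "\<dots> = ((r_circ_gram grp ?r X ** D_mat grp rho A ?s + lam *\<^sub>R weight_mat grp w) ** ?T) $ i $ m"
      by (simp add: matrix_matrix_mult_def[of _ ?T] r_circ_gram_D_mat weight_mat_def)
    finally show ?thesis
      using right by (simp add: M_mat_def)
  qed
  then show ?thesis
    by (simp add: matrix_def vec_eq_iff)
qed

lemma negligible_stratum:
  assumes "K \<noteq> {}"
  shows "negligible (stratum K)"
proof -
  obtain k where "k \<in> K"
    using assms by blast
  have "z $ inv c (Inr k) = 0" if "z \<in> stratum K" for z
  proof -
    have "R z \<in> \<Delta>" "sp (R z) $ k = 0"
      using that \<open>k \<in> K\<close> by (auto simp: stratum_def Dom_def)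
    from zero_in_F[OF this] show ?thesis
      by (simp add: right_coords_def)
  qed
  then show ?thesis
    using negligible_subset[OF negligible_standard_hyperplane_cart[of "inv c (Inr k)"]] by blast
qed

lemma negligible_image_stratum:
  assumes "K \<noteq> {}"
  shows "negligible (G ` stratum K)"
  using negligible_stratum[OF assms] G_has_derivative
  by (intro negligible_differentiable_image_negligible)
    (auto simp: differentiable_on_def differentiable_def)

lemma Dom_strata: "Dom = stratum {} \<union> (\<Union>K\<in>- {{}}. stratum K)"
proof (intro equalityI subsetI)
  fix z assume "z \<in> Dom"
  then obtain K where "z \<in> stratum K"
    by (simp add: stratum_def)
  then show "z \<in> stratum {} \<union> (\<Union>K\<in>- {{}}. stratum K)"
    by (cases "K = {}") auto
qed (auto simp: stratum_def)

text \<open>Differentiable images of measurable sets are Lebesgue measurable, and there are only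
  finitely many strata.\<close>

lemma lebesgue_image_G: "G ` Dom \<in> sets lebesgue"
proof -
  have "G ` stratum K \<in> sets lebesgue" for K
    using stratum_borel[of K] G_has_derivative
    by (intro differentiable_image_in_sets_lebesgue)
      (auto simp: differentiable_on_def differentiable_def)
  then show ?thesis
    unfolding Dom_strata image_Un image_UN by (intro sets.Un sets.finite_UN) auto
qed

lemma AE_lborel_negligible: "negligible N \<Longrightarrow> AE x in lborel. x \<notin> N"
  by (metis AE_completion_iff AE_not_in negligible_iff_null_sets)

text \<open>The strata other than \<open>stratum {}\<close> drop out on both sides: on the left
  their images are null, on the right they are null themselves.\<close>

lemma nn_integral_image_G:
  assumes g: "g \<in> borel_measurable borel" "\<And>x. 0 \<le> g x" "(\<integral>\<^sup>+x. ennreal (g x) \<partial>lborel) < \<infinity>"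
  shows "(\<integral>\<^sup>+v\<in>G ` Dom. ennreal (g v) \<partial>lborel)
       = (\<integral>\<^sup>+z\<in>Dom. ennreal (g (G z) * \<bar>det (M_mat c grp rho w X A (L z) (sp (R z)) (T (R z)) lam)\<bar>) \<partial>lborel)"
proof -
  have sub: "stratum {} \<subseteq> Dom"
    by (auto simp: stratum_def)
  have "negligible (\<Union>K\<in>- {{}}. G ` stratum K)" "negligible (\<Union>K\<in>- {{}}. stratum K)"
    using negligible_image_stratum negligible_stratum by (auto intro!: negligible_Union)
  note ae = this[THEN AE_lborel_negligible]
  have "(\<integral>\<^sup>+v\<in>G ` Dom. ennreal (g v) \<partial>lborel) = (\<integral>\<^sup>+v\<in>G ` stratum {}. ennreal (g v) \<partial>lborel)"
    by (rule nn_integral_cong_AE, rule AE_mp[OF ae(1)])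
      (use Dom_strata sub in \<open>auto simp: indicator_def\<close>)
  also have "\<dots> = (\<integral>\<^sup>+z\<in>stratum {}. ennreal (\<bar>det (matrix (G' z))\<bar> * g (G z)) \<partial>lborel)"
    by (rule nn_integral_change_of_variables[OF stratum_borel G_has_derivative inj_on_subset[OF inj_on_G sub] g])
  also have "\<dots> = (\<integral>\<^sup>+z\<in>Dom. ennreal (g (G z) * \<bar>det (M_mat c grp rho w X A (L z) (sp (R z)) (T (R z)) lam)\<bar>) \<partial>lborel)"
    by (rule nn_integral_cong_AE, rule AE_mp[OF ae(2)])
      (use Dom_strata in \<open>auto simp: indicator_def matrix_G' mult.commute\<close>)
  finally show ?thesis .
qed

lemma measurable_integrand:
  assumes g: "g \<in> borel_measurable borel"
  shows "(\<lambda>(r, u). ennreal (g (H_map grp rho w X A r (sp u) \<beta>0 lam)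
      * \<bar>det (M_mat c grp rho w X A r (sp u) (T u) lam)\<bar>) * indicator \<Delta> u * indicator \<Gamma> r)
    \<in> borel_measurable (borel \<Otimes>\<^sub>M borel)"
proof -
  let ?N = "borel \<Otimes>\<^sub>M borel :: ((real^'j) \<times> (real^'p)) measure"
  let ?s = "\<lambda>x. if snd x \<in> \<Delta> then sp (snd x) else 0"
  \<comment> \<open>\<open>M_mat\<close> with \<open>sp\<close> and the columns of \<open>T\<close>
    replaced by their measurable cut-offs; the two agree wherever the indicator of \<Delta> is
    nonzero.\<close>
  define M where "M = (\<lambda>x. \<chi> i l. case c l of
      Inl j \<Rightarrow> (gram X *v eta_vec rho (block grp j (?s x))) $ i
    | Inr k \<Rightarrow> (\<Sum>m\<in>UNIV. (fst x $ grp m * gram X $ i $ m * (if grp m \<in> A then eta' rho (?s x $ m) else 0)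
        + lam * weight_mat grp w $ i $ m) * (if snd x \<in> \<Delta> then column k (T (snd x)) else 0) $ m))"
  have s: "?s \<in> borel_measurable ?N"
    using measurable_compose[OF measurable_snd measurable_sp] .
  have s_m: "(\<lambda>x. ?s x $ m) \<in> borel_measurable ?N" for m
    by (rule measurable_vec_nth[OF s])
  have r_m: "(\<lambda>x. fst x $ j) \<in> borel_measurable ?N" for j
    by (rule measurable_vec_nth[OF measurable_fst])
  have "(\<lambda>x. M x $ i $ l) \<in> borel_measurable ?N" for i l
  proof (cases l rule: enum_cases[OF columns, case_names left right])
    case (left j)
    have "(\<lambda>x. eta rho (block grp j (?s x) $ k)) \<in> borel_measurable ?N" for k
      using measurable_compose[OF measurable_vec_nth[OF measurable_compose[OF s borel_measurable_block]] borel_measurable_eta] .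
    then have "(\<lambda>x. eta_vec rho (block grp j (?s x))) \<in> borel_measurable ?N"
      unfolding eta_vec_def by (rule measurable_vec_lambda)
    from measurable_vec_nth[OF measurable_matrix_vector_mult[OF this]] left
    show ?thesis by (simp add: M_def)
  next
    case (right k)
    have "(\<lambda>x. (if snd x \<in> \<Delta> then column k (T (snd x)) else 0) $ m) \<in> borel_measurable ?N" for m
      using measurable_vec_nth[OF measurable_compose[OF measurable_snd measurable_column_T[OF right(1)]]] .
    moreover have "(\<lambda>x. if grp m \<in> A then eta' rho (?s x $ m) else 0) \<in> borel_measurable ?N" for m
      using measurable_compose[OF s_m borel_measurable_eta'] by (cases "grp m \<in> A") simp_all
    ultimately show ?thesis
      using right r_m unfolding M_def
      by (simp del: vec_lambda_beta cong: if_cong add: vec_lambda_beta)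
  qed
  then have M: "(\<lambda>x. det (M x)) \<in> borel_measurable ?N"
    by (rule borel_measurable_det)
  have "(\<lambda>x. gram X *v estimate grp rho A (fst x) (?s x) + lam *\<^sub>R (weight_mat grp w *v ?s x) - gram X *v \<beta>0)
      \<in> borel_measurable ?N"
    by (intro borel_measurable_add borel_measurable_diff borel_measurable_scaleR borel_measurable_const
        measurable_matrix_vector_mult measurable_estimate measurable_fst s)
  from measurable_compose[OF this g]
  have H: "(\<lambda>x. g (H_map grp rho w X A (fst x) (?s x) \<beta>0 lam)) \<in> borel_measurable ?N"
    unfolding H_map_eq .
  have ind: "(\<lambda>x. indicator \<Delta> (snd x) :: ennreal) \<in> borel_measurable ?N"
      "(\<lambda>x. indicator \<Gamma> (fst x) :: ennreal) \<in> borel_measurable ?N"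
    using Gamma(1) Delta(1) by (auto intro: measurable_compose[OF measurable_snd] measurable_compose[OF measurable_fst])
  have "(\<lambda>x. ennreal (g (H_map grp rho w X A (fst x) (?s x) \<beta>0 lam) * \<bar>det (M x)\<bar>) * indicator \<Delta> (snd x) * indicator \<Gamma> (fst x))
      \<in> borel_measurable ?N"
    using M H ind by measurable
  also have "(\<lambda>x. ennreal (g (H_map grp rho w X A (fst x) (?s x) \<beta>0 lam) * \<bar>det (M x)\<bar>) * indicator \<Delta> (snd x) * indicator \<Gamma> (fst x))
    = (\<lambda>(r, u). ennreal (g (H_map grp rho w X A r (sp u) \<beta>0 lam)
      * \<bar>det (M_mat c grp rho w X A r (sp u) (T u) lam)\<bar>) * indicator \<Delta> u * indicator \<Gamma> r)"
  proof (intro ext, clarify)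
    fix r u
    have "M (r, u) = M_mat c grp rho w X A r (sp u) (T u) lam" if "u \<in> \<Delta>"
      using that by (simp add: M_def M_mat_def vec_eq_iff matrix_matrix_mult_def[of _ "T u"] r_circ_gram_D_mat
          column_def split: sum.split cong: if_cong)
    then show "ennreal (g (H_map grp rho w X A (fst (r, u)) (?s (r, u)) \<beta>0 lam) * \<bar>det (M (r, u))\<bar>)
          * indicator \<Delta> (snd (r, u)) * indicator \<Gamma> (fst (r, u))
        = ennreal (g (H_map grp rho w X A r (sp u) \<beta>0 lam)
          * \<bar>det (M_mat c grp rho w X A r (sp u) (T u) lam)\<bar>) * indicator \<Delta> u * indicator \<Gamma> r"
      by (cases "u \<in> \<Delta>") simp_all
  qed
  finally show ?thesis .
qed

lemma nn_integral_Dom: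
  assumes g: "g \<in> borel_measurable borel"
  shows "(\<integral>\<^sup>+z\<in>Dom. ennreal (g (G z) * \<bar>det (M_mat c grp rho w X A (L z) (sp (R z)) (T (R z)) lam)\<bar>) \<partial>lborel)
    = (\<integral>\<^sup>+r\<in>\<Gamma>. (\<integral>\<^sup>+u\<in>\<Delta>. ennreal (g (H_map grp rho w X A r (sp u) \<beta>0 lam)
        * \<bar>det (M_mat c grp rho w X A r (sp u) (T u) lam)\<bar>) \<partial>coord_lborel F) \<partial>coord_lborel A)"
    (is "?lhs = ?rhs")
proof -
  have "?rhs = (\<integral>\<^sup>+r. \<integral>\<^sup>+u. ennreal (g (H_map grp rho w X A r (sp u) \<beta>0 lam)
        * \<bar>det (M_mat c grp rho w X A r (sp u) (T u) lam)\<bar>) * indicator \<Delta> u * indicator \<Gamma> r \<partial>coord_lborel F \<partial>coord_lborel A)"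
    by (intro nn_integral_cong) (auto simp: indicator_def)
  also have "\<dots> = ?lhs"
    using nn_integral_coord_lborel[OF columns measurable_integrand[OF g]]
    by (auto simp: G_def Dom_def indicator_def intro!: nn_integral_cong)
  finally show ?thesis ..
qed

section \<open>The estimator event as a preimage under the noise term\<close>

definition estimator_event :: "'a measure \<Rightarrow> ('a \<Rightarrow> real^'p) \<Rightarrow> ('a \<Rightarrow> real^'p) \<Rightarrow> 'a set" where
  "estimator_event \<Omega> \<beta>hat S = {\<omega> \<in> space \<Omega>. coord_proj A (block_norms grp p (\<beta>hat \<omega>)) \<in> \<Gamma>
            \<and> S \<omega> \<in> sp ` \<Delta> \<and> active_set grp (\<beta>hat \<omega>) = A}"

context
  fixes \<Omega> :: "'a measure" and U :: "'a \<Rightarrow> real^'p" and \<beta>hat S :: "'a \<Rightarrow> real^'p"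
  assumes U: "U \<in> borel_measurable \<Omega>"
    and dual: "\<And>\<omega>. \<omega> \<in> space \<Omega> \<Longrightarrow> dual_pair grp p q (\<beta>hat \<omega>) (S \<omega>)"
    and eq: "\<And>\<omega>. \<omega> \<in> space \<Omega> \<Longrightarrow>
      gram X *v \<beta>hat \<omega> + lam *\<^sub>R (weight_mat grp w *v S \<omega>) = gram X *v \<beta>0 + U \<omega>"
begin

text \<open>On the event the defining equation expresses \<open>U\<close> through
  \<open>H_map\<close>. Conversely, if \<open>U\<close> lies in the image, the pair reconstructed
  from \<open>(r, u)\<close> solves the same equation as the estimator and its subgradient, so it
  coincides with them.\<close>

lemma event_eq: "estimator_event \<Omega> \<beta>hat S = {\<omega> \<in> space \<Omega>. U \<omega> \<in> G ` Dom}"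
proof (intro set_eqI iffI)
  fix \<omega> assume "\<omega> \<in> estimator_event \<Omega> \<beta>hat S"
  then obtain u where \<omega>: "\<omega> \<in> space \<Omega>" "coord_proj A (block_norms grp p (\<beta>hat \<omega>)) \<in> \<Gamma>"
    "u \<in> \<Delta>" "S \<omega> = sp u" "active_set grp (\<beta>hat \<omega>) = A"
    by (auto simp: estimator_event_def)
  have "U \<omega> = H_map grp rho w X A (coord_proj A (block_norms grp p (\<beta>hat \<omega>))) (sp u) \<beta>0 lam"
    using dual_pair_subgrad_space(2)[OF dual[OF \<omega>(1)]] eq[OF \<omega>(1)] \<omega>
    by (simp add: H_map_eq algebra_simps)
  with \<omega> show "\<omega> \<in> {\<omega> \<in> space \<Omega>. U \<omega> \<in> G ` Dom}"
    unfolding image_G_Dom by blast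
next
  fix \<omega> assume "\<omega> \<in> {\<omega> \<in> space \<Omega>. U \<omega> \<in> G ` Dom}"
  then obtain r u where \<omega>: "\<omega> \<in> space \<Omega>" "r \<in> \<Gamma>" "u \<in> \<Delta>"
      "U \<omega> = H_map grp rho w X A r (sp u) \<beta>0 lam"
    unfolding image_G_Dom by blast
  have "gram X *v \<beta>hat \<omega> + lam *\<^sub>R (weight_mat grp w *v S \<omega>)
      = gram X *v estimate grp rho A r (sp u) + lam *\<^sub>R (weight_mat grp w *v sp u)"
    using eq[OF \<omega>(1)] \<omega>(4) by (simp add: H_map_eq)
  from dual_pair_unique[OF rank weights lam dual[OF \<omega>(1)] estimate_sp(1)[OF \<omega>(2,3)] this]
  show "\<omega> \<in> estimator_event \<Omega> \<beta>hat S"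
    using estimate_sp[OF \<omega>(2,3)] \<omega> by (simp add: estimator_event_def)
qed

text \<open>By \<open>eq\<close>, the difference of two left sides in the stability estimate is the
  difference of two values of \<open>U\<close>.\<close>

lemma measurable_estimator: "\<beta>hat \<in> borel_measurable \<Omega>"
proof -
  obtain d where d: "0 < d"
    "\<And>b s b' s'. dual_pair grp p q b s \<Longrightarrow> dual_pair grp p q b' s' \<Longrightarrow>
       d * norm (b - b') \<le> norm ((gram X *v b + lam *\<^sub>R (weight_mat grp w *v s))
                                - (gram X *v b' + lam *\<^sub>R (weight_mat grp w *v s')))"
    using dual_pair_stability[OF rank] weights lam by metis
  show ?thesis
    by (rule borel_measurable_of_dist_le[OF U d(1)]) (use d(2)[OF dual dual] in \<open>simp add: dist_norm eq\<close>)
qed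

lemma measurable_subgradient: "S \<in> borel_measurable \<Omega>"
proof -
  let ?f = "\<lambda>\<omega>. gram X *v \<beta>0 + U \<omega> - gram X *v \<beta>hat \<omega>"
  have "?f \<in> borel_measurable \<Omega>"
    by (intro borel_measurable_add borel_measurable_diff borel_measurable_const
        measurable_matrix_vector_mult measurable_estimator U)
  then have "(\<lambda>\<omega>. \<chi> k. ?f \<omega> $ k / (lam * w $ grp k)) \<in> borel_measurable \<Omega>"
    by (intro measurable_vec_lambda borel_measurable_divide borel_measurable_const measurable_vec_nth)
  moreover have "(\<chi> k. ?f \<omega> $ k / (lam * w $ grp k)) = S \<omega>" if "\<omega> \<in> space \<Omega>" for \<omega>
  proof -
    have "?f \<omega> = lam *\<^sub>R (weight_mat grp w *v S \<omega>)"
      using eq[OF that] by (simp add: algebra_simps)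
    moreover have "w $ j \<noteq> 0" for j
      using weights by (metis less_irrefl)
    ultimately show ?thesis
      using lam by (simp add: vec_eq_iff)
  qed
  ultimately show ?thesis
    by (simp cong: measurable_cong)
qed

lemma event_in_sets: "estimator_event \<Omega> \<beta>hat S \<in> sets \<Omega>"
proof -
  have b: "(\<lambda>\<omega>. block grp j (\<beta>hat \<omega>)) \<in> borel_measurable \<Omega>" for j
    using measurable_compose[OF measurable_estimator borel_measurable_block] .
  have "(\<lambda>\<omega>. block_norms grp p (\<beta>hat \<omega>)) \<in> borel_measurable \<Omega>"
    unfolding block_norms_def
    by (intro measurable_vec_lambda measurable_compose[OF b borel_measurable_lp_norm])
  from measurable_compose[OF this borel_measurable_coord_proj]
  have 1: "{\<omega> \<in> space \<Omega>. coord_proj A (block_norms grp p (\<beta>hat \<omega>)) \<in> \<Gamma>} \<in> sets \<Omega>"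
    using Gamma(1) by measurable
  \<comment> \<open>Since \<open>sp\<close> inverts the projection on \<Phi>0, the image can be
    written as a preimage, for which Borel measurability is immediate.\<close>
  have sp_Delta_eq: "sp ` \<Delta> = \<Phi>0 \<inter> coord_proj F -` \<Delta>"
    using sp_Delta param by (auto simp: parameterized_by_def image_iff) metis
  obtain O' where "open O'" "\<Phi>0 = subgrad_space grp q A \<inter> O'"
    using Phi0 by (auto simp: openin_open)
  then have "\<Phi>0 \<in> sets borel"
    using subgrad_space_borel[of grp q A] borel_open[of O'] by auto
  then have "sp ` \<Delta> \<in> sets borel"
    unfolding sp_Delta_eq using measurable_sets[OF borel_measurable_coord_proj Delta(1)] by simp
  then have 2: "{\<omega> \<in> space \<Omega>. S \<omega> \<in> sp ` \<Delta>} \<in> sets \<Omega>"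
    using measurable_subgradient by measurable
  have "{\<omega> \<in> space \<Omega>. active_set grp (\<beta>hat \<omega>) = A}
      = {\<omega> \<in> space \<Omega>. \<forall>j. (block grp j (\<beta>hat \<omega>) \<noteq> 0) = (j \<in> A)}"
    by (auto simp: active_set_def)
  also have "\<dots> \<in> sets \<Omega>"
    using b by measurable
  finally have 3: "{\<omega> \<in> space \<Omega>. active_set grp (\<beta>hat \<omega>) = A} \<in> sets \<Omega>" .
  have "estimator_event \<Omega> \<beta>hat S = {\<omega> \<in> space \<Omega>. coord_proj A (block_norms grp p (\<beta>hat \<omega>)) \<in> \<Gamma>}
      \<inter> {\<omega> \<in> space \<Omega>. S \<omega> \<in> sp ` \<Delta>} \<inter> {\<omega> \<in> space \<Omega>. active_set grp (\<beta>hat \<omega>) = A}"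
    by (auto simp: estimator_event_def)
  with 1 2 3 show ?thesis by simp
qed

lemma emeasure_event:
  assumes D: "distributed \<Omega> lborel U (\<lambda>x. ennreal (g x))" and g: "\<And>x. 0 \<le> g x"
    and fin: "finite_measure \<Omega>"
  shows "emeasure \<Omega> (estimator_event \<Omega> \<beta>hat S) = (\<integral>\<^sup>+r\<in>\<Gamma>. (\<integral>\<^sup>+u\<in>\<Delta>. ennreal (g (H_map grp rho w X A r (sp u) \<beta>0 lam)
        * \<bar>det (M_mat c grp rho w X A r (sp u) (T u) lam)\<bar>) \<partial>coord_lborel F) \<partial>coord_lborel A)"
proof -
  have g': "g \<in> borel_measurable borel"
    using measurable_compose[OF distributed_borel_measurable[OF D], of enn2real borel] g by simp
  \<comment> \<open>The change of variables asks for a finite integral of \<open>g\<close>; it is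
    the total mass of \<Omega>.\<close>
  have "(\<integral>\<^sup>+x. ennreal (g x) \<partial>lborel) = emeasure \<Omega> (U -` UNIV \<inter> space \<Omega>)"
    using distributed_emeasure[OF D, of UNIV] by simp
  then have g_fin: "(\<integral>\<^sup>+x. ennreal (g x) \<partial>lborel) < \<infinity>"
    using finite_measure.emeasure_finite[OF fin] by (simp add: less_top)
  have "emeasure \<Omega> (estimator_event \<Omega> \<beta>hat S) = (\<integral>\<^sup>+v\<in>G ` Dom. ennreal (g v) \<partial>lborel)"
    unfolding event_eq
    by (rule emeasure_distributed_lebesgue[OF D lebesgue_image_G]) (use event_in_sets event_eq in simp)
  also note nn_integral_image_G[OF g' g g_fin]
  also note nn_integral_Dom[OF g']
  finally show ?thesis .
qed

end

end

theorem corollary3p5: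
  fixes X :: "real^'p^'n"
    and grp :: "'p \<Rightarrow> 'j::finite"
    and w :: "real^'j"
    and alpha alphas lam sigma :: real
    and \<beta>0 :: "real^'p"
    and \<Omega> :: "'a measure"
    and \<epsilon> y :: "'a \<Rightarrow> real^'n"
    and \<beta>hat S :: "'a \<Rightarrow> real^'p"
    and g :: "real^'p \<Rightarrow> real"
    and A :: "'j set"
    and F :: "'p set"
    and \<Gamma> :: "(real^'j) set"
    and \<Phi>0 \<Delta> :: "(real^'p) set"
    and sp :: "real^'p \<Rightarrow> real^'p"
    and T :: "real^'p \<Rightarrow> real^'p^'p"
    and c :: "'p \<Rightarrow> 'j + 'p"
  assumes groups: "surj grp"
    and weights: "\<forall>j. w $ j > 0"
    and alpha: "1 < alpha"
    and conj: "1 / alpha + 1 / alphas = 1"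
    and n_gt_p: "CARD('n) > CARD('p)"
    and lam: "lam > 0"
    and full_rank: "rank X = CARD('p)"
    and prob: "prob_space \<Omega>"
    and indep: "prob_space.indep_vars \<Omega> (\<lambda>_. borel) (\<lambda>i \<omega>. \<epsilon> \<omega> $ i) UNIV"
    and ident: "\<forall>i i'. distr \<Omega> borel (\<lambda>\<omega>. \<epsilon> \<omega> $ i) = distr \<Omega> borel (\<lambda>\<omega>. \<epsilon> \<omega> $ i')"
    and mean: "\<forall>i. integrable \<Omega> (\<lambda>\<omega>. \<epsilon> \<omega> $ i) \<and> (\<integral>\<omega>. \<epsilon> \<omega> $ i \<partial>\<Omega>) = 0"
    and var: "\<forall>i. integrable \<Omega> (\<lambda>\<omega>. (\<epsilon> \<omega> $ i)\<^sup>2) \<and> (\<integral>\<omega>. (\<epsilon> \<omega> $ i)\<^sup>2 \<partial>\<Omega>) = sigma\<^sup>2"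
    and g_nonneg: "\<forall>x. 0 \<le> g x"
    and density: "distributed \<Omega> lborel
          (\<lambda>\<omega>. (1 / real CARD('n)) *\<^sub>R (transpose X *v \<epsilon> \<omega>)) (\<lambda>x. ennreal (g x))"
    and model: "\<forall>\<omega>\<in>space \<Omega>. y \<omega> = X *v \<beta>0 + \<epsilon> \<omega>"
    and lasso: "\<forall>\<omega>\<in>space \<Omega>. block_lasso grp alpha w lam X (y \<omega>) (\<beta>hat \<omega>)"
    and subgradient: "\<forall>\<omega>\<in>space \<Omega>. lasso_subgradient grp w lam X (y \<omega>) (\<beta>hat \<omega>) (S \<omega>)"
    and Gamma: "\<Gamma> \<in> sets borel" "\<Gamma> \<subseteq> {r \<in> coord_space A. \<forall>j\<in>A. r $ j > 0}"
    and F_card: "card F = CARD('p) - card A"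
    and Phi0: "openin (top_of_set (subgrad_space grp alphas A)) \<Phi>0"
    and param: "parameterized_by F \<Phi>0 sp T"
    and Delta: "\<Delta> \<in> sets borel" "\<Delta> \<subseteq> coord_proj F ` \<Phi>0"
    and columns: "bij_betw c UNIV (A <+> F)"
  shows "{\<omega> \<in> space \<Omega>. coord_proj A (block_norms grp alpha (\<beta>hat \<omega>)) \<in> \<Gamma>
            \<and> S \<omega> \<in> sp ` \<Delta> \<and> active_set grp (\<beta>hat \<omega>) = A} \<in> sets \<Omega>
       \<and> emeasure \<Omega> {\<omega> \<in> space \<Omega>. coord_proj A (block_norms grp alpha (\<beta>hat \<omega>)) \<in> \<Gamma>
            \<and> S \<omega> \<in> sp ` \<Delta> \<and> active_set grp (\<beta>hat \<omega>) = A}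
         = (\<integral>\<^sup>+ r\<in>\<Gamma>. (\<integral>\<^sup>+ u\<in>\<Delta>.
              ennreal (g (H_map grp (alphas / alpha) w X A r (sp u) \<beta>0 lam)
                * \<bar>det (M_mat c grp (alphas / alpha) w X A r (sp u) (T u) lam)\<bar>)
              \<partial>coord_lborel F) \<partial>coord_lborel A)"
proof -
  interpret parameterized_lasso alpha alphas X grp w lam \<beta>0 A F \<Gamma> \<Phi>0 \<Delta> sp T c
    using weights alpha conj lam full_rank Gamma Phi0 param Delta columns by unfold_locales auto
  let ?U = "\<lambda>\<omega>. (1 / real CARD('n)) *\<^sub>R (transpose X *v \<epsilon> \<omega>)"
  have U: "?U \<in> borel_measurable \<Omega>"
    using distributed_measurable[OF density] by simp
  have dual: "dual_pair grp alpha alphas (\<beta>hat \<omega>) (S \<omega>)" if "\<omega> \<in> space \<Omega>" for \<omega>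
    using block_lasso_dual_pair[OF weights lam] lasso subgradient that by blast
  \<comment> \<open>The model splits the right side of the subgradient equation into signal and
    noise.\<close>
  have eq: "gram X *v \<beta>hat \<omega> + lam *\<^sub>R (weight_mat grp w *v S \<omega>) = gram X *v \<beta>0 + ?U \<omega>"
    if "\<omega> \<in> space \<Omega>" for \<omega>
    using subgradient model that
    by (simp add: lasso_subgradient_def gram_mult matrix_vector_right_distrib scaleR_right_distrib
        del: transpose_matrix_vector)
  show ?thesis
    using event_in_sets[OF U dual eq] emeasure_event[OF U dual eq density] g_nonneg
      prob_space.finite_measure[OF prob]
    unfolding estimator_event_def by blast
qed

end
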